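(* Let $n\ge 3$ and $1\le k\le n$. 1. $F_{n,k}(1/2/3,1/23)=1$ when $k=1$, and equals $rs^{n-1}+qrs^{n-2}t$ when $k=2$. 2. $F_{n,k}(1/2/3,13/2)=1$ when $k=1$, and equals $\sum_{i=1}^{n-1}r^{i}s^{n-i}$ when $k=2$. 3. $F_{n,k}(1/2/3,12/3)=1$ when $k=1$, and equals $r^{n-1}s+q^{n-2}rst$ when $k=2$. 4. $F_{n,k}(1/23,13/2)=1$ when $k=1$, and equals $r^{\frac{k(k-1)}{2}}s^{\frac{(k-1)(2n-k)}{2}}$ otherwise. 5. $F_{n,k}(1/23,12/3)=1$ when $k=1$, equals $(rs)^{\binom{k}{2}}$ when $k=n$, and equals $(qt)^{k-1}(rs)^{\binom{k}{2}}$ when $k=n-1$. 6. $F_{n,k}(1/23,123)=(rs)^{\binom{k}{2}}$ when $k=n$, and equals $r^{\binom{n-1}{2}}\sum_{i=0}^{n-2}(qt)^{i}s^{\binom{n}{2}-i-1}$ when $k=n-1$. 7. $F_{n,k}(13/2,12/3)=1$ when $k=1$, and equals $r^{\frac{(k-1)(2n-k)}{2}}s^{\frac{(k-1)k}{2}}$ otherwise. 8. $F_{n,k}(13/2,123)=\sum_{L}r^{\binom{k}{2}+\sum_{l\in L}(l-1)}s^{\binom{k}{2}+\sum_{l\in L}(k-l)}$, where $L$ runs over all subsets $L=\{l_1,\dots,l_{n-k}\}$ of $[k]$ with $l_1>l_2>\cdots>l_{n-k}$. 9. $F_{n,k}(12/3,123)=(rs)^{n(n-1)/2}$ when $k=n$,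 and equals $s^{\binom{n-1}{2}}\sum_{i=0}^{n-2}(qt)^{i}r^{\frac{n(n-1)}{2}-i-1}$ when $k=n-1$.
   Context: A set partition $\pi=B_1/B_2/\cdots/B_k$ of $[n]=\{1,\dots,n\}$ is written with its blocks ordered so that $\min B_1<\min B_2<\cdots<\min B_k$. For $S\subseteq[n]$, restrict $\pi$ to $S$ by taking the nonempty intersections $B_i\cap S$, and standardize by replacing the smallest element of $S$ by $1$, the second smallest by $2$, etc. The partition $\pi$ contains a partition $\omega$ if the standardized restriction to some $S$ equals $\omega$; otherwise $\pi$ avoids $\omega$. The five partitions of $[3]$ are written $1/2/3$, $1/23$, $13/2$, $12/3$, $123$, where blocks are separated by slashes (e.g. $13/2=\{\{1,3\},\{2\}\}$). For a set $P$ of partitions of $[3]$, $\Pi_{n,k}(P)$ is the set of partitions of $[n]$ with exactly $k$ blocks that avoid every element of $P$. The restricted growth function (RGF) of $\pi$ is the word $w(\pi)=a_1\cdots a_n$ with $a_i=j$ iff $i\in B_j$. For a word $w=a_1\cdots a_n$ put $lb(a_j)=\#\{a_i: i<j,\ a_i>a_j\}$, $ls(a_j)=\#\{a_i: i<j,\ a_i<a_j\}$, $rb(a_j)=\#\{a_i: i>j,\ a_i>a_j\}$, $rs(a_j)=\#\{a_i: i>j,\ a_i<a_j\}$, where each is the cardinality of a set of values (distinct letters are counted once), and let $lb(w)=\sum_j lb(a_j)$, and similarly for $ls,rb,rs$. For a partition $\pi$, $lb(\pi)=lb(w(\pi))$, etc. $$F_{n,k}(P)=F_{n,k}(P;q,r,s,t)=\sum_{\pi\in\Pi_{n,k}(P)}q^{lb(\pi)}r^{ls(\pi)}s^{rb(\pi)}t^{rs(\pi)},$$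 and $F_{n,k}(\omega_1,\omega_2)$ means $F_{n,k}(\{\omega_1,\omega_2\})$. *)

theory Defs
  imports "HOL-Library.Disjoint_Sets"
begin

text \<open>
  Set partitions of \<open>[n] = {1..n}\<close> are sets of blocks, i.e. terms \<open>\<pi> :: nat set set\<close> with
  \<open>partition_on {1..n} \<pi>\<close>.
\<close>

subsection \<open>Pattern containment\<close>

definition restrict_partition :: "nat set set \<Rightarrow> nat set \<Rightarrow> nat set set" where
  "restrict_partition \<pi> S = {B \<inter> S | B. B \<in> \<pi> \<and> B \<inter> S \<noteq> {}}"

text \<open>For finite \<open>S\<close> and \<open>x \<in> S\<close>, \<open>rank_in S x = i\<close> iff \<open>x\<close> is the \<open>i\<close>-th smallest element of \<open>S\<close>.\<close>

definition rank_in :: "nat set \<Rightarrow> nat \<Rightarrow> nat" where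
  "rank_in S x = card {y \<in> S. y \<le> x}"

definition standardize :: "nat set \<Rightarrow> nat set set \<Rightarrow> nat set set" where
  "standardize S \<sigma> = (\<lambda>B. rank_in S ` B) ` \<sigma>"

text \<open>The ground set of \<open>\<pi>\<close> is \<open>\<Union>\<pi>\<close>.\<close>

definition contains_pattern :: "nat set set \<Rightarrow> nat set set \<Rightarrow> bool" where
  "contains_pattern \<pi> \<omega> \<longleftrightarrow> (\<exists>S \<subseteq> \<Union>\<pi>. standardize S (restrict_partition \<pi> S) = \<omega>)"

definition avoids :: "nat set set \<Rightarrow> nat set set \<Rightarrow> bool" where
  "avoids \<pi> \<omega> \<longleftrightarrow> \<not> contains_pattern \<pi> \<omega>"

text \<open>The five partitions of \<open>[3]\<close>; an underscore in a name stands for a slash.\<close>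

definition pat_1_2_3 :: "nat set set" where "pat_1_2_3 = {{1}, {2}, {3}}"
definition pat_1_23 :: "nat set set" where "pat_1_23 = {{1}, {2, 3}}"
definition pat_13_2 :: "nat set set" where "pat_13_2 = {{1, 3}, {2}}"
definition pat_12_3 :: "nat set set" where "pat_12_3 = {{1, 2}, {3}}"
definition pat_123 :: "nat set set" where "pat_123 = {{1, 2, 3}}"

definition avoiders :: "nat \<Rightarrow> nat \<Rightarrow> nat set set set \<Rightarrow> nat set set set" where
  "avoiders n k P =
     {\<pi>. partition_on {1..n} \<pi> \<and> card \<pi> = k \<and> (\<forall>\<omega>\<in>P. avoids \<pi> \<omega>)}"

lemma finite_avoiders: "finite (avoiders n k P)"
  by (rule finite_subset[OF _ finitely_many_partition_on[of "{1..n}"]])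
     (auto simp: avoiders_def)


subsection \<open>Restricted growth functions\<close>

text \<open>The blocks in order of increasing minima; the list is 0-indexed, so the block written
  \<open>B\<^sub>j\<close> is \<open>blocks \<pi> ! (j - 1)\<close>.\<close>

definition blocks :: "nat set set \<Rightarrow> nat set list" where
  "blocks \<pi> = sorted_key_list_of_set Min \<pi>"

definition rgf :: "nat \<Rightarrow> nat set set \<Rightarrow> nat list" where
  "rgf n \<pi> = map (\<lambda>i. THE j. 1 \<le> j \<and> j \<le> card \<pi> \<and> i \<in> blocks \<pi> ! (j - 1)) [1..<n + 1]"

text \<open>This is stated inside the class because the locale \<open>folding_insort_key\<close>, interpreted at a
  concrete type, speaks about \<open>linorder.sorted_key_list_of_set (\<le>)\<close> instead of the class
  constant.\<close>

lemma (in linorder) sorted_key_list_of_set_inj_on: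
  assumes "inj_on f A" "finite A"
  shows "set (sorted_key_list_of_set f A) = A"
    "length (sorted_key_list_of_set f A) = card A"
    "sorted_wrt (<) (map f (sorted_key_list_of_set f A))"
proof -
  interpret folding_insort_key "(\<le>)" "(<)" A f
    using assms(1) by unfold_locales
  show "set (sorted_key_list_of_set f A) = A"
    "length (sorted_key_list_of_set f A) = card A"
    "sorted_wrt (<) (map f (sorted_key_list_of_set f A))"
    using assms(2) by simp_all
qed

lemma inj_on_Min_partition:
  assumes "partition_on A \<pi>" "finite A"
  shows "inj_on Min \<pi>"
proof (rule inj_onI)
  fix B C assume BC: "B \<in> \<pi>" "C \<in> \<pi>" "Min B = Min C"
  have ne: "B \<noteq> {}" "C \<noteq> {}"
    using BC assms(1) by (auto simp: partition_on_def)
  have "B \<subseteq> A" "C \<subseteq> A"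
    using BC assms(1) by (auto simp: partition_on_def)
  then have "finite B" "finite C"
    using assms(2) finite_subset by blast+
  then have "Min B \<in> B" "Min B \<in> C"
    using Min_in[of B] Min_in[of C] ne by (simp_all only: BC(3) not_False_eq_True)
  then show "B = C"
    using assms(1) BC by (auto simp: partition_on_def disjoint_def)
qed

lemma blocks:
  assumes "partition_on {1..n} \<pi>"
  shows "set (blocks \<pi>) = \<pi>" "length (blocks \<pi>) = card \<pi>" "distinct (blocks \<pi>)"
    "sorted_wrt (\<lambda>B C. Min B < Min C) (blocks \<pi>)"
proof -
  have inj: "inj_on Min \<pi>" and fin: "finite \<pi>"
    using assms inj_on_Min_partition finite_elements by blast+
  show "set (blocks \<pi>) = \<pi>" "length (blocks \<pi>) = card \<pi>"
    using sorted_key_list_of_set_inj_on(1,2)[OF inj fin] by (simp_all only: blocks_def)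
  have "sorted_wrt (<) (map Min (blocks \<pi>))"
    using sorted_key_list_of_set_inj_on(3)[OF inj fin] by (simp only: blocks_def)
  then show "sorted_wrt (\<lambda>B C. Min B < Min C) (blocks \<pi>)" "distinct (blocks \<pi>)"
    by (simp add: sorted_wrt_map, simp only: strict_sorted_iff distinct_map)
qed

lemma rgf_eq_iff:
  assumes "partition_on {1..n} \<pi>" "1 \<le> i" "i \<le> n" "1 \<le> j" "j \<le> card \<pi>"
  shows "rgf n \<pi> ! (i - 1) = j \<longleftrightarrow> i \<in> blocks \<pi> ! (j - 1)"
proof -
  let ?Q = "\<lambda>j. 1 \<le> j \<and> j \<le> card \<pi> \<and> i \<in> blocks \<pi> ! (j - 1)"
  note b = blocks[OF assms(1)]
  have "i \<in> \<Union>\<pi>"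
    using assms by (auto simp: partition_on_def)
  then obtain B where B: "B \<in> set (blocks \<pi>)" "i \<in> B"
    unfolding b(1) by blast
  then obtain m where m: "m < card \<pi>" "i \<in> blocks \<pi> ! m"
    unfolding in_set_conv_nth b(2) by blast
  have uniq: "x = y" if Q: "?Q x" "?Q y" for x y
  proof -
    have len: "x - 1 < length (blocks \<pi>)" "y - 1 < length (blocks \<pi>)"
      using Q unfolding b(2) by linarith+
    then have mem: "blocks \<pi> ! (x - 1) \<in> \<pi>" "blocks \<pi> ! (y - 1) \<in> \<pi>"
      using nth_mem b(1) by blast+
    have "blocks \<pi> ! (x - 1) = blocks \<pi> ! (y - 1)"
      using disjointD[OF partition_onD2[OF assms(1)] mem] Q by blast
    then have "x - 1 = y - 1"
      using nth_eq_iff_index_eq[OF b(3) len] by blast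
    then show "x = y" using Q by linarith
  qed
  have Qm: "?Q (Suc m)" using m by simp
  then have the: "(THE j. ?Q j) = Suc m"
    using uniq[OF _ Qm] by (rule the_equality)
  have "rgf n \<pi> ! (i - 1) = (THE j. ?Q j)"
    unfolding rgf_def using assms(2,3)
    by (subst nth_map) (simp_all add: nth_upt del: upt_Suc)
  then have "rgf n \<pi> ! (i - 1) = Suc m"
    using the by simp
  moreover have "Suc m = j \<longleftrightarrow> i \<in> blocks \<pi> ! (j - 1)"
    using uniq[OF Qm, of j] Qm assms(4,5) by blast
  ultimately show ?thesis by simp
qed


subsection \<open>The four statistics on words\<close>

text \<open>Each letter contributes the cardinality of a set of values, so repeated letters are counted
  once.\<close>

definition lb :: "nat list \<Rightarrow> nat" where
  "lb w = (\<Sum>j<length w. card {w ! i | i. i < j \<and> w ! i > w ! j})"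

definition ls :: "nat list \<Rightarrow> nat" where
  "ls w = (\<Sum>j<length w. card {w ! i | i. i < j \<and> w ! i < w ! j})"

definition rb :: "nat list \<Rightarrow> nat" where
  "rb w = (\<Sum>j<length w. card {w ! i | i. j < i \<and> i < length w \<and> w ! i > w ! j})"

definition rs :: "nat list \<Rightarrow> nat" where
  "rs w = (\<Sum>j<length w. card {w ! i | i. j < i \<and> i < length w \<and> w ! i < w ! j})"


subsection \<open>The generating function\<close>

text \<open>
  The indeterminates are rendered as elements of an arbitrary commutative semiring. An identity
  for all \<open>q r s t\<close> over all such types is the same as an identity of formal polynomials, since the
  type can be instantiated by a polynomial ring (e.g. an iterated \<open>poly\<close> over \<open>int\<close>) and
  \<open>q r s t\<close> by its variables.
\<close>

definition F ::
  "nat \<Rightarrow> nat \<Rightarrow> nat set set set \<Rightarrow> 'a \<Rightarrow> 'a \<Rightarrow> 'a \<Rightarrow> 'a \<Rightarrow> 'a :: comm_semiring_1" where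
  "F n k P q r s t =
     (\<Sum>\<pi>\<in>avoiders n k P.
        q ^ lb (rgf n \<pi>) * r ^ ls (rgf n \<pi>) * s ^ rb (rgf n \<pi>) * t ^ rs (rgf n \<pi>))"

end

theory Submission
  imports Defs "HOL-Library.Sublist" "HOL-Library.Multiset"
begin

text \<open>
  The map sending a partition to its restricted growth function is a bijection onto the words
  \<open>w\<close> with letters \<open>1, ..., k\<close> in which every letter is preceded by all smaller ones, and a
  pattern \<open>\<omega>\<close> is contained in \<open>\<pi>\<close> iff \<open>w(\<pi>)\<close> has a three-letter subword whose letters coincide
  exactly as prescribed by \<open>\<omega>\<close>. Avoiding \<open>13/2\<close> means that \<open>w\<close> is weakly increasing; then
  \<open>lb = rs = 0\<close>, a letter \<open>x\<close> contributes \<open>x - 1\<close> to \<open>ls\<close> and \<open>k - x\<close> to \<open>rb\<close>, and \<open>w\<close> is determined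
  by the multiset \<open>N\<close> of its surplus letters, so that \<open>F\<close> becomes a sum over multisets. For
  \<open>k = n - 1\<close> the words are \<open>1 ... m a (m+1) ... (n-1)\<close> with \<open>a \<le> m\<close>: avoiding \<open>1/23\<close> means
  \<open>a = 1\<close>, avoiding \<open>12/3\<close> means \<open>m = n - 1\<close>. For \<open>k = 1\<close> and \<open>k = n\<close> there is
  a single word.
\<close>

subsection \<open>Recursions for the statistics\<close>

text \<open>Restricted growth makes \<open>ls\<close> independent of the arrangement: 1, ..., x - 1
  all precede x, so only the multiset of letters matters. \<open>rb\<close> behaves in the same way
  wherever every larger letter still follows; this holds in sorted words and, in the words with one
  repetition, for every letter except the inserted one. One copy of each letter then gives the
  constant \<open>k choose 2\<close> in both exponents, and the formulas differ only in what the
  surplus letters add. A weakly increasing word starts with 1 and ends with \<open>k\<close>. Hence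
  1/23 leaves only surplus letters 1, 12/3 only surplus letters \<open>k\<close>, and 123 turns the
  surplus multiset into a set. For two blocks the pattern 1/2/3 cannot occur. Paired with 13/2 it
  gives all weakly increasing words; paired with 1/23 or 12/3 it leaves two words each, namely
  1...12 and 1...121, respectively 12...2 and 121...1, whose weights are found directly.\<close>

lemma nth_snoc_image:
  assumes "j \<le> length w"
  shows "{(w @ [x]) ! i | i. i < j \<and> P ((w @ [x]) ! i)} = {w ! i | i. i < j \<and> P (w ! i)}"
proof -
  have "y = (w @ [x]) ! i \<and> i < j \<and> P ((w @ [x]) ! i) \<longleftrightarrow> y = w ! i \<and> i < j \<and> P (w ! i)" for y i
    using assms by (cases "i < j") (simp_all add: nth_append)
  then show ?thesis by presburger
qed

lemma nth_image_filter: "{w ! i | i. i < length w \<and> P (w ! i)} = {y \<in> set w. P y}"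
  unfolding set_conv_nth by blast

text \<open>\<open>lb\<close> and \<open>ls\<close> look only at earlier letters, so appending a
  letter leaves the old contributions unchanged. \<open>rb\<close> and \<open>rs\<close> look at
  later letters and therefore get their recursions from prepending.\<close>

lemma lb_snoc: "lb (w @ [x]) = lb w + card {y \<in> set w. x < y}"
proof -
  have "card {(w @ [x]) ! i | i. i < j \<and> (w @ [x]) ! j < (w @ [x]) ! i}
      = card {w ! i | i. i < j \<and> w ! j < w ! i}" if "j < length w" for j
    using nth_snoc_image[of j w x "\<lambda>y. w ! j < y"] that by (simp add: nth_append_left)
  moreover have "{(w @ [x]) ! i | i. i < length w \<and> x < (w @ [x]) ! i} = {y \<in> set w. x < y}"
    using nth_snoc_image[of "length w" w x "\<lambda>y. x < y"] nth_image_filter[of w "\<lambda>y. x < y"]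
    by simp
  ultimately show ?thesis by (simp add: lb_def cong: sum.cong_simp)
qed

lemma ls_snoc: "ls (w @ [x]) = ls w + card {y \<in> set w. y < x}"
proof -
  have "card {(w @ [x]) ! i | i. i < j \<and> (w @ [x]) ! i < (w @ [x]) ! j}
      = card {w ! i | i. i < j \<and> w ! i < w ! j}" if "j < length w" for j
    using nth_snoc_image[of j w x "\<lambda>y. y < w ! j"] that by (simp add: nth_append_left)
  moreover have "{(w @ [x]) ! i | i. i < length w \<and> (w @ [x]) ! i < x} = {y \<in> set w. y < x}"
    using nth_snoc_image[of "length w" w x "\<lambda>y. y < x"] nth_image_filter[of w "\<lambda>y. y < x"]
    by simp
  ultimately show ?thesis by (simp add: ls_def cong: sum.cong_simp)
qed

lemma nth_Cons_image:
  "{(x # w) ! i | i. Suc j < i \<and> i < length (x # w) \<and> P ((x # w) ! i)}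
    = {w ! i | i. j < i \<and> i < length w \<and> P (w ! i)}" (is "?L = ?R")
proof
  show "?L \<subseteq> ?R" by (auto simp: nth_Cons less_Suc_eq_0_disj)
  show "?R \<subseteq> ?L"
  proof
    fix y assume "y \<in> ?R"
    then obtain i where "y = w ! i" "j < i" "i < length w" "P (w ! i)" by blast
    then show "y \<in> ?L" by (intro CollectI exI[of _ "Suc i"]) simp
  qed
qed

lemma nth_Cons_image_0:
  "{(x # w) ! i | i. 0 < i \<and> i < length (x # w) \<and> P ((x # w) ! i)} = {y \<in> set w. P y}"
  (is "?L = ?R")
proof
  show "?L \<subseteq> ?R" by (auto simp: nth_Cons less_Suc_eq_0_disj)
  show "?R \<subseteq> ?L"
  proof
    fix y assume "y \<in> ?R"
    then obtain i where "y = w ! i" "i < length w" "P (w ! i)" by (auto simp: in_set_conv_nth)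
    then show "y \<in> ?L" by (intro CollectI exI[of _ "Suc i"]) simp
  qed
qed

lemma rb_Cons: "rb (x # w) = rb w + card {y \<in> set w. x < y}"
proof -
  have "{(x # w) ! i | i. Suc j < i \<and> i < Suc (length w) \<and> w ! j < (x # w) ! i}
      = {w ! i | i. j < i \<and> i < length w \<and> w ! j < w ! i}" for j
    using nth_Cons_image[of x w j "\<lambda>y. w ! j < y"] by simp
  moreover have "{(x # w) ! i | i. 0 < i \<and> i < Suc (length w) \<and> x < (x # w) ! i} = {y \<in> set w. x < y}"
    using nth_Cons_image_0[of x w "\<lambda>y. x < y"] by simp
  ultimately show ?thesis
    by (simp add: rb_def sum.lessThan_Suc_shift del: sum.lessThan_Suc)
qed

lemma rs_Cons: "rs (x # w) = rs w + card {y \<in> set w. y < x}"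
proof -
  have "{(x # w) ! i | i. Suc j < i \<and> i < Suc (length w) \<and> (x # w) ! i < w ! j}
      = {w ! i | i. j < i \<and> i < length w \<and> w ! i < w ! j}" for j
    using nth_Cons_image[of x w j "\<lambda>y. y < w ! j"] by simp
  moreover have "{(x # w) ! i | i. 0 < i \<and> i < Suc (length w) \<and> (x # w) ! i < x} = {y \<in> set w. y < x}"
    using nth_Cons_image_0[of x w "\<lambda>y. y < x"] by simp
  ultimately show ?thesis
    by (simp add: rs_def sum.lessThan_Suc_shift del: sum.lessThan_Suc)
qed

lemma stats_Nil [simp]: "lb [] = 0" "ls [] = 0" "rb [] = 0" "rs [] = 0"
  by (simp_all add: lb_def ls_def rb_def rs_def)

text \<open>No letter of the tail has a larger one before it. This cuts off the increasing end of a
  word; \<open>rs_append_increasing\<close> does the same for an increasing beginning.\<close>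

lemma lb_append_increasing:
  assumes "sorted v" "\<And>x y. x \<in> set u \<Longrightarrow> y \<in> set v \<Longrightarrow> x \<le> y"
  shows "lb (u @ v) = lb u"
  using assms
proof (induction v rule: rev_induct)
  case (snoc x v)
  have "{y \<in> set (u @ v). x < y} = {}"
    using snoc.prems by (fastforce simp: sorted_append)
  then have "lb ((u @ v) @ [x]) = lb (u @ v)"
    by (simp only: lb_snoc) simp
  then show ?case using snoc by (simp add: sorted_append)
qed simp

lemma rs_append_increasing:
  assumes "sorted u" "\<And>x y. x \<in> set u \<Longrightarrow> y \<in> set v \<Longrightarrow> x \<le> y"
  shows "rs (u @ v) = rs v"
  using assms
proof (induction u)
  case (Cons x u)
  have "{y \<in> set (u @ v). y < x} = {}"
    using Cons.prems by fastforce
  then have "rs (x # u @ v) = rs (u @ v)"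
    by (simp only: rs_Cons) simp
  then show ?case using Cons by simp
qed simp

lemma lb_sorted: "sorted w \<Longrightarrow> lb w = 0"
  using lb_append_increasing[of w "[]"] by simp

lemma rs_sorted: "sorted w \<Longrightarrow> rs w = 0"
  using rs_append_increasing[of w "[]"] by simp

text \<open>When every value in \<open>{x<..k}\<close> still occurs to the right of
  \<open>x\<close>, that letter contributes \<open>k - x\<close> wherever it stands. The hypothesis
  ranges over all splittings of \<open>u\<close> because the letters after \<open>x\<close> are
  those of \<open>u2 @ v\<close>.\<close>

lemma rb_append:
  assumes "\<And>u1 x u2. u = u1 @ x # u2 \<Longrightarrow> {y \<in> set (u2 @ v). x < y} = {x<..k}"
  shows "rb (u @ v) = (\<Sum>x\<leftarrow>u. k - x) + rb v"
  using assms
proof (induction u)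
  case (Cons x u)
  have "rb (u @ v) = (\<Sum>x\<leftarrow>u. k - x) + rb v"
    by (rule Cons.IH) (metis Cons.prems append_Cons)
  moreover have "{y \<in> set (u @ v). x < y} = {x<..k}"
    using Cons.prems[of "[]"] by simp
  ultimately show ?case by (simp add: rb_Cons)
qed simp

subsection \<open>Words of restricted growth\<close>

text \<open>For positive letters the last condition is equivalent to the usual one, that a letter is
  at most one more than the maximum of its predecessors. The form with a splitting supplies the
  earlier occurrences directly.\<close>

definition rgf_words :: "nat \<Rightarrow> nat \<Rightarrow> nat list set" where
  "rgf_words n k = {w. length w = n \<and> set w = {1..k} \<and>
     (\<forall>u x v. w = u @ x # v \<longrightarrow> {1..<x} \<subseteq> set u)}"

text \<open>The smaller values before \<open>x\<close> are exactly 1, ..., x - 1. No alphabet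
  \<open>{1..k}\<close> is fixed, since a prefix of the word need not contain all letters and the
  induction runs over prefixes.\<close>

lemma ls_restricted_growth:
  assumes "0 \<notin> set w" "\<And>u x v. w = u @ x # v \<Longrightarrow> {1..<x} \<subseteq> set u"
  shows "ls w = (\<Sum>x\<leftarrow>w. x - 1)"
  using assms
proof (induction w rule: rev_induct)
  case (snoc x w)
  have "{1..<x} \<subseteq> set w" using snoc.prems(2)[of w x "[]"] by simp
  then have "{y \<in> set w. y < x} = {1..<x}"
    using snoc.prems(1) by (auto simp: Suc_le_eq intro!: gr0I)
  moreover have "ls w = (\<Sum>x\<leftarrow>w. x - 1)"
    using snoc.prems by (intro snoc.IH) auto
  ultimately show ?case by (simp add: ls_snoc)
qed simp

lemma ls_rgf_words: "w \<in> rgf_words n k \<Longrightarrow> ls w = (\<Sum>x\<leftarrow>w. x - 1)"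
  by (rule ls_restricted_growth) (auto simp: rgf_words_def)

text \<open>In a sorted word no value above \<open>x\<close> can stand before \<open>x\<close>, so
  all of them stand after it.\<close>

lemma rb_sorted:
  assumes "sorted w" "set w = {1..k}"
  shows "rb w = (\<Sum>x\<leftarrow>w. k - x)"
proof -
  have "{y \<in> set v. x < y} = {x<..k}" if w: "w = u @ x # v" for u x v
  proof -
    have "set v \<subseteq> {1..k}" using assms(2) w by auto
    moreover have "y \<in> set v" if "x < y" "y \<le> k" for y
    proof -
      have "y \<in> set w" using that assms(2) by auto
      then show ?thesis using assms(1) that w by (auto simp: sorted_append)
    qed
    ultimately show ?thesis by auto
  qed
  then show ?thesis using rb_append[of w "[]" k] by simp
qed

lemma sorted_in_rgf_words:
  assumes "sorted w" "set w = {1..k}" "length w = n"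
  shows "w \<in> rgf_words n k"
proof -
  have "y \<in> set u" if w: "w = u @ x # v" and "1 \<le> y" "y < x" for u x v y
  proof -
    have "x \<in> set w" using w by simp
    then have "x \<le> k" using assms(2) by simp
    then have "y \<in> set w" unfolding assms(2) using that by simp
    then show ?thesis using assms(1) that w by (auto simp: sorted_append)
  qed
  then show ?thesis using assms unfolding rgf_words_def by auto
qed

lemma sorted_if_splits:
  assumes "\<And>u x v y. w = u @ x # v \<Longrightarrow> y \<in> set v \<Longrightarrow> x \<le> y"
  shows "sorted w"
  using assms
proof (induction w)
  case (Cons a w)
  have "sorted w" by (rule Cons.IH) (metis Cons.prems append_Cons)
  moreover have "a \<le> y" if "y \<in> set w" for y
    using Cons.prems[of "[]" a w y] that by simp
  ultimately show ?case by simp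
qed simp

section \<open>Three-letter subwords and multiplicities of letters\<close>

lemma subseq_replicate_iff: "subseq (replicate m a) w \<longleftrightarrow> m \<le> count (mset w) a"
proof (induction w arbitrary: m)
  case Nil
  then show ?case by (cases m) auto
next
  case (Cons x w)
  show ?case
  proof (cases m)
    case (Suc l)
    show ?thesis
    proof (cases "x = a")
      case True
      then show ?thesis using Cons[of l] Suc by simp
    next
      case False
      then show ?thesis using Cons[of m] Suc by simp
    qed
  qed simp
qed

lemma subseq_two_iff: "subseq [a, a] w \<longleftrightarrow> 2 \<le> count (mset w) a"
  using subseq_replicate_iff[of 2 a w] by (simp add: numeral_2_eq_2)

lemma subseq_three_iff: "subseq [a, a, a] w \<longleftrightarrow> 3 \<le> count (mset w) a"
  using subseq_replicate_iff[of 3 a w] by (simp add: numeral_3_eq_3)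

lemma subseq_Cons_iff_nth:
  "subseq (x # xs) ys \<longleftrightarrow> (\<exists>i<length ys. ys ! i = x \<and> subseq xs (drop (Suc i) ys))"
proof
  assume "subseq (x # xs) ys"
  then obtain us vs where "ys = us @ x # vs" "subseq xs vs"
    by (auto dest: list_emb_ConsD)
  then show "\<exists>i<length ys. ys ! i = x \<and> subseq xs (drop (Suc i) ys)"
    by (intro exI[of _ "length us"]) simp
next
  assume "\<exists>i<length ys. ys ! i = x \<and> subseq xs (drop (Suc i) ys)"
  then obtain i where "i < length ys" "ys ! i = x" "subseq xs (drop (Suc i) ys)" by blast
  then have "ys = take i ys @ x # drop (Suc i) ys" "subseq (x # xs) (x # drop (Suc i) ys)"
    using id_take_nth_drop[of i ys] by auto
  then show "subseq (x # xs) ys" by (metis list_emb_append2)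
qed

lemma subseq_three_iff_nth:
  "subseq [a, b, c] w \<longleftrightarrow>
    (\<exists>i j l. i < j \<and> j < l \<and> l < length w \<and> w ! i = a \<and> w ! j = b \<and> w ! l = c)" (is "?L \<longleftrightarrow> ?R")
proof
  assume ?L
  then obtain i j l where "i < length w" "w ! i = a" "j < length w - Suc i" "w ! (Suc i + j) = b"
    "l < length w - Suc i - Suc j" "w ! (Suc i + Suc j + l) = c"
    unfolding subseq_Cons_iff_nth by (auto simp: add_ac)
  then show ?R
    by (intro exI[of _ i] exI[of _ "Suc i + j"] exI[of _ "Suc i + Suc j + l"]) auto
next
  assume ?R
  then obtain i j l where ij: "i < j" "j < l" "l < length w" and w: "w ! i = a" "w ! j = b" "w ! l = c"
    by blast
  have "subseq [c] (drop (Suc j) w)"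
    unfolding subseq_Cons_iff_nth using ij w by (intro exI[of _ "l - Suc j"]) auto
  then have "subseq [b, c] (drop (Suc i) w)"
    unfolding subseq_Cons_iff_nth[of b] using ij w by (intro exI[of _ "j - Suc i"]) auto
  then show ?L
    unfolding subseq_Cons_iff_nth[of a] using ij w by (intro exI[of _ i]) auto
qed

text \<open>If \<open>x > y\<close> is a descent, then \<open>y\<close> also occurs before \<open>x\<close> by restricted growth.\<close>

lemma sorted_iff_avoids_13_2:
  assumes "w \<in> rgf_words n k"
  shows "sorted w \<longleftrightarrow> (\<nexists>a b. a \<noteq> b \<and> subseq [a, b, a] w)"
proof
  assume "sorted w"
  then show "\<nexists>a b. a \<noteq> b \<and> subseq [a, b, a] w"
    unfolding subseq_three_iff_nth by (metis le_antisym less_imp_le_nat order_less_trans sorted_iff_nth_mono)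
next
  assume av: "\<nexists>a b. a \<noteq> b \<and> subseq [a, b, a] w"
  show "sorted w"
  proof (rule sorted_if_splits, rule ccontr)
    fix u x v y assume w: "w = u @ x # v" and y: "y \<in> set v" "\<not> x \<le> y"
    have "y \<in> set w" using w y by simp
    then have "y \<in> {1..<x}" using y assms by (auto simp: rgf_words_def)
    moreover have "{1..<x} \<subseteq> set u" using assms w unfolding rgf_words_def by blast
    ultimately have "subseq [y] u" "subseq [y] v" using y by (auto simp: subseq_singleton_left)
    then have "subseq ([y] @ x # [y]) (u @ x # v)"
      by (intro list_emb_append_mono) auto
    then have "subseq [y, x, y] w" using w by simp
    moreover have "y \<noteq> x" using y by simp
    ultimately show False using av by blast
  qed
qed

subsection \<open>From partitions to words\<close>

lemma blocks_nth_mem: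
  assumes "partition_on {1..n} \<pi>" "j \<in> {1..card \<pi>}"
  shows "blocks \<pi> ! (j - 1) \<in> \<pi>"
proof -
  have "j - 1 < length (blocks \<pi>)"
    unfolding blocks(2)[OF assms(1)] using assms(2) by auto
  then show ?thesis using nth_mem blocks(1)[OF assms(1)] by blast
qed

text \<open>The word determines the partition. This gives injectivity and lets restrictions be
  computed from letters, without the block list.\<close>

lemma partition_eq_rgf_fibres:
  assumes "partition_on {1..n} \<pi>"
  shows "\<pi> = (\<lambda>j. {i \<in> {1..n}. rgf n \<pi> ! (i - 1) = j}) ` {1..card \<pi>}"
proof -
  note b = blocks(1,2)[OF assms]
  note mem = blocks_nth_mem[OF assms]
  have "blocks \<pi> ! (j - 1) = {i \<in> {1..n}. rgf n \<pi> ! (i - 1) = j}" if j: "j \<in> {1..card \<pi>}" for j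
  proof -
    have "blocks \<pi> ! (j - 1) \<subseteq> {1..n}"
      using mem[OF j] partition_onD1[OF assms] by blast
    then show ?thesis using rgf_eq_iff[OF assms, of _ j] j by auto
  qed
  then have "(\<lambda>j. blocks \<pi> ! (j - 1)) ` {1..card \<pi>}
      = (\<lambda>j. {i \<in> {1..n}. rgf n \<pi> ! (i - 1) = j}) ` {1..card \<pi>}"
    by (rule image_cong[OF refl])
  moreover have "\<pi> = (\<lambda>j. blocks \<pi> ! (j - 1)) ` {1..card \<pi>}"
  proof
    show "\<pi> \<subseteq> (\<lambda>j. blocks \<pi> ! (j - 1)) ` {1..card \<pi>}"
    proof
      fix B assume "B \<in> \<pi>"
      then obtain i where "i < card \<pi>" "blocks \<pi> ! i = B"
        using b by (metis in_set_conv_nth)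
      then show "B \<in> (\<lambda>j. blocks \<pi> ! (j - 1)) ` {1..card \<pi>}"
        by (intro image_eqI[of _ _ "Suc i"]) auto
    qed
  qed (use mem in blast)
  ultimately show ?thesis by simp
qed

lemma rgf_letter:
  assumes "partition_on {1..n} \<pi>" "i \<in> {1..n}"
  shows "rgf n \<pi> ! (i - 1) \<in> {1..card \<pi>}"
proof -
  have "i \<in> \<Union>\<pi>" using assms by (auto simp: partition_on_def)
  then obtain B where "B \<in> \<pi>" "i \<in> B" by blast
  moreover from this obtain j where "j \<in> {1..card \<pi>}" "B = {i \<in> {1..n}. rgf n \<pi> ! (i - 1) = j}"
    by (subst (asm) partition_eq_rgf_fibres[OF assms(1)]) blast
  ultimately show ?thesis by blast
qed

lemma length_rgf [simp]: "length (rgf n \<pi>) = n"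
  by (simp add: rgf_def)

text \<open>Restricted growth reflects the order of the blocks by minima: for \<open>y < x\<close>
  the minimum of block \<open>y\<close> is a position holding \<open>y\<close>, and it lies before
  the minimum of block \<open>x\<close>, hence before every position holding
  \<open>x\<close>.\<close>

lemma rgf_in_rgf_words:
  assumes "partition_on {1..n} \<pi>"
  shows "rgf n \<pi> \<in> rgf_words n (card \<pi>)"
proof -
  let ?w = "rgf n \<pi>"
  note block = blocks_nth_mem[OF assms]
  have Min_block: "Min (blocks \<pi> ! (j - 1)) \<in> {1..n} \<and> ?w ! (Min (blocks \<pi> ! (j - 1)) - 1) = j"
    if j: "j \<in> {1..card \<pi>}" for j
  proof -
    have sub: "blocks \<pi> ! (j - 1) \<subseteq> {1..n}"
      using block[OF j] partition_onD1[OF assms] by blast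
    moreover have "blocks \<pi> ! (j - 1) \<noteq> {}"
      using block[OF j] partition_onD3[OF assms] by metis
    ultimately have "Min (blocks \<pi> ! (j - 1)) \<in> blocks \<pi> ! (j - 1)"
      by (meson Min_in finite_atLeastAtMost finite_subset)
    then show ?thesis using sub rgf_eq_iff[OF assms, of _ j] j by auto
  qed
  have set: "set ?w = {1..card \<pi>}"
  proof
    show "set ?w \<subseteq> {1..card \<pi>}"
    proof
      fix x assume "x \<in> set ?w"
      then obtain i where "i < n" "x = ?w ! i" by (auto simp: in_set_conv_nth)
      then show "x \<in> {1..card \<pi>}" using rgf_letter[OF assms, of "Suc i"] by simp
    qed
    show "{1..card \<pi>} \<subseteq> set ?w"
    proof
      fix j assume "j \<in> {1..card \<pi>}"
      define m where "m = Min (blocks \<pi> ! (j - 1))"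
      have "m \<in> {1..n}" "?w ! (m - 1) = j"
        using Min_block[OF \<open>j \<in> _\<close>] unfolding m_def by blast+
      then show "j \<in> set ?w" using nth_mem[of "m - 1" ?w] by auto
    qed
  qed
  have "{1..<x} \<subseteq> set u" if w: "?w = u @ x # v" for u x v
  proof
    fix y assume y: "y \<in> {1..<x}"
    let ?i = "Suc (length u)" and ?m = "Min (blocks \<pi> ! (y - 1))"
    have "x \<in> set ?w" unfolding w by simp
    then have x: "x \<in> {1..card \<pi>}" using set by simp
    then have y': "y \<in> {1..card \<pi>}" using y by auto
    have len: "?i \<le> n" using arg_cong[OF w, of length] by simp
    have "?w ! (?i - 1) = x" by (simp add: w)
    then have mem: "?i \<in> blocks \<pi> ! (x - 1)" using rgf_eq_iff[OF assms, of ?i x] len x by simp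
    have "blocks \<pi> ! (x - 1) \<subseteq> {1..n}"
      using block[OF x] partition_onD1[OF assms] by blast
    then have "Min (blocks \<pi> ! (x - 1)) \<le> ?i"
      using mem by (meson Min_le finite_atLeastAtMost finite_subset)
    moreover have "?m < Min (blocks \<pi> ! (x - 1))"
      using sorted_wrt_nth_less[OF blocks(4)[OF assms], of "y - 1" "x - 1"] blocks(2)[OF assms] x y
      by auto
    ultimately have "?m - 1 < length u" "?w ! (?m - 1) = y" using Min_block[OF y'] by auto
    then show "y \<in> set u" by (metis w nth_append nth_mem)
  qed
  then show ?thesis using set unfolding rgf_words_def by simp blast
qed

lemma rgf_inj:
  "inj_on (rgf n) {\<pi>. partition_on {1..n} \<pi> \<and> card \<pi> = k}"
proof (rule inj_onI)
  fix \<pi> \<rho> assume "\<pi> \<in> {\<pi>. partition_on {1..n} \<pi> \<and> card \<pi> = k}"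
    "\<rho> \<in> {\<pi>. partition_on {1..n} \<pi> \<and> card \<pi> = k}" and eq: "rgf n \<pi> = rgf n \<rho>"
  then have P: "partition_on {1..n} \<pi>" "card \<pi> = k" "partition_on {1..n} \<rho>" "card \<rho> = k"
    by simp_all
  note eqs = partition_eq_rgf_fibres[OF P(1)] partition_eq_rgf_fibres[OF P(3)]
  show "\<pi> = \<rho>"
    by (rule trans[OF eqs(1)[unfolded P(2,4) eq] eqs(2)[unfolded P(2,4), symmetric]])
qed

text \<open>By restricted growth some \<open>a\<close> precedes the first \<open>b\<close>. This is
  what makes the order of the letters agree with the order of the fibres by minima.\<close>

lemma Min_fibre_less:
  assumes w: "w \<in> rgf_words n k" and ab: "1 \<le> a" "a < b" "b \<le> k"
  shows "Min {i \<in> {1..n}. w ! (i - 1) = a} < Min {i \<in> {1..n}. w ! (i - 1) = b}"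
proof -
  let ?A = "{i \<in> {1..n}. w ! (i - 1) = a}" and ?B = "{i \<in> {1..n}. w ! (i - 1) = b}"
  have len: "length w = n" using w by (simp add: rgf_words_def)
  have "b \<in> set w" using w ab by (simp add: rgf_words_def)
  then obtain i where "i < n" "w ! i = b" using len by (auto simp: in_set_conv_nth)
  then have "Suc i \<in> ?B" by simp
  then have "Min ?B \<in> ?B" by (intro Min_in) auto
  then obtain i where i: "Min ?B = Suc i" "i < n" "w ! i = b"
    by (intro that[of "Min ?B - 1"]) auto
  have "w = take i w @ b # drop (Suc i) w"
    using i len id_take_nth_drop by blast
  then have "{1..<b} \<subseteq> set (take i w)" using w unfolding rgf_words_def by blast
  then have "a \<in> set (take i w)" using ab by auto
  then obtain j where j: "j < i" "w ! j = a" using i len by (auto simp: in_set_conv_nth)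
  then have "Min ?A \<le> Suc j" using i by (intro Min_le) auto
  also have "\<dots> < Min ?B" unfolding i(1) using j by simp
  finally show ?thesis .
qed

text \<open>The preimage is the partition into fibres of \<open>w\<close>. What needs proof is that
  \<open>blocks\<close> lists these fibres in the order of their letters.\<close>

lemma rgf_surj:
  assumes w: "w \<in> rgf_words n k"
  obtains \<pi> where "partition_on {1..n} \<pi>" "card \<pi> = k" "rgf n \<pi> = w"
proof -
  let ?b = "\<lambda>j. {i \<in> {1..n}. w ! (i - 1) = j}"
  let ?\<pi> = "?b ` {1..k}"
  have len: "length w = n" and set: "set w = {1..k}" using w by (simp_all add: rgf_words_def)
  have letter: "w ! (i - 1) \<in> {1..k}" if "i \<in> {1..n}" for i
    using that len set nth_mem[of "i - 1" w] by auto
  have ne: "?b j \<noteq> {}" if "j \<in> {1..k}" for j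
  proof -
    obtain i where "i < n" "w ! i = j" using \<open>j \<in> {1..k}\<close> set len by (metis in_set_conv_nth)
    then have "Suc i \<in> ?b j" by simp
    then show ?thesis by blast
  qed
  have part: "partition_on {1..n} ?\<pi>"
  proof (rule partition_onI)
    show "\<Union> ?\<pi> = {1..n}" using letter by auto
    show "disjnt p q" if "p \<in> ?\<pi>" "q \<in> ?\<pi>" "p \<noteq> q" for p q
      using that by (auto simp: disjnt_def)
    show "{} \<notin> ?\<pi>" using ne by (metis (no_types, lifting) imageE)
  qed
  have "inj_on ?b {1..k}"
  proof (rule linorder_inj_onI)
    fix a b assume "a < b" "a \<in> {1..k}" "b \<in> {1..k}"
    then have "Min (?b a) < Min (?b b)" using Min_fibre_less[OF w] by simp
    then show "?b a \<noteq> ?b b" by (intro notI) (simp only: less_irrefl)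
  qed auto
  then have card: "card ?\<pi> = k" by (simp add: card_image)
  \<comment> \<open>Both lists of minima are strictly increasing with the same set of entries, hence
    equal; injectivity of \<open>Min\<close> on the blocks then removes \<open>Min\<close>.\<close>
  have "map Min (blocks ?\<pi>) = map (\<lambda>j. Min (?b j)) [1..<k+1]"
  proof (rule sorted_distinct_set_unique)
    have "sorted_wrt (<) (map Min (blocks ?\<pi>))"
      using blocks(4)[OF part] by (simp add: sorted_wrt_map)
    then show "sorted (map Min (blocks ?\<pi>))" "distinct (map Min (blocks ?\<pi>))"
      by (simp_all only: strict_sorted_iff)
    have "sorted_wrt (<) (map (\<lambda>j. Min (?b j)) [1..<k+1])"
      unfolding sorted_wrt_map
      by (rule sorted_wrt_mono_rel[OF _ sorted_wrt_upt]) (use Min_fibre_less[OF w] in auto)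
    then show "sorted (map (\<lambda>j. Min (?b j)) [1..<k+1])" "distinct (map (\<lambda>j. Min (?b j)) [1..<k+1])"
      by (simp_all only: strict_sorted_iff)
    show "set (map Min (blocks ?\<pi>)) = set (map (\<lambda>j. Min (?b j)) [1..<k+1])"
      using blocks(1)[OF part] by (simp add: image_image atLeastLessThanSuc_atLeastAtMost del: upt_Suc)
  qed
  then have "map Min (blocks ?\<pi>) = map Min (map ?b [1..<k+1])" by (simp add: comp_def)
  moreover have "inj_on Min (set (blocks ?\<pi>) \<union> set (map ?b [1..<k+1]))"
    using inj_on_Min_partition[OF part] blocks(1)[OF part]
    by (simp add: atLeastLessThanSuc_atLeastAtMost del: upt_Suc)
  ultimately have blocks_eq: "blocks ?\<pi> = map ?b [1..<k+1]"
    using map_inj_on by blast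
  have "rgf n ?\<pi> = w"
  proof (rule nth_equalityI)
    fix i assume "i < length (rgf n ?\<pi>)"
    then have i: "i < n" by simp
    then have l: "w ! i \<in> {1..k}" using letter[of "Suc i"] by simp
    have "Suc i \<in> blocks ?\<pi> ! (w ! i - 1)"
      unfolding blocks_eq using i l by (subst nth_map) (auto simp del: upt_Suc)
    then show "rgf n ?\<pi> ! i = w ! i"
      using rgf_eq_iff[OF part, of "Suc i" "w ! i"] i l card by simp
  qed (simp add: len)
  with part card show thesis by (rule that)
qed

lemma bij_betw_rgf:
  "bij_betw (rgf n) {\<pi>. partition_on {1..n} \<pi> \<and> card \<pi> = k} (rgf_words n k)"
proof (rule bij_betw_imageI[OF rgf_inj], intro set_eqI iffI)
  fix w assume "w \<in> rgf n ` {\<pi>. partition_on {1..n} \<pi> \<and> card \<pi> = k}"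
  then show "w \<in> rgf_words n k" using rgf_in_rgf_words by blast
next
  fix w assume "w \<in> rgf_words n k"
  then obtain \<pi> where "partition_on {1..n} \<pi>" "card \<pi> = k" "rgf n \<pi> = w"
    by (rule rgf_surj)
  then show "w \<in> rgf n ` {\<pi>. partition_on {1..n} \<pi> \<and> card \<pi> = k}"
    by (intro image_eqI[of _ _ \<pi>]) simp_all
qed

section \<open>Pattern containment read off the word\<close>

lemma restrict_partition_rgf:
  assumes "partition_on {1..n} \<pi>" "S \<subseteq> {1..n}"
  shows "restrict_partition \<pi> S = (\<lambda>x. {y \<in> S. rgf n \<pi> ! (y - 1) = rgf n \<pi> ! (x - 1)}) ` S"
    (is "?L = ?R")
proof -
  let ?f = "\<lambda>i. rgf n \<pi> ! (i - 1)"
  note eq = partition_eq_rgf_fibres[OF assms(1)]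
  have block: "{i \<in> {1..n}. ?f i = ?f x} \<in> \<pi>" if "x \<in> S" for x
  proof (rule subsetD[OF equalityD2[OF eq]], rule image_eqI[OF refl])
    show "?f x \<in> {1..card \<pi>}" using rgf_letter[OF assms(1), of x] that assms(2) by blast
  qed
  have fibre: "B = {i \<in> {1..n}. ?f i = ?f x}" if "B \<in> \<pi>" "x \<in> B" for B x
    using equalityD1[OF eq, THEN subsetD, OF that(1)] that(2) by blast
  show ?thesis
  proof
    show "?L \<subseteq> ?R"
    proof
      fix C assume "C \<in> ?L"
      then obtain B x where B: "B \<in> \<pi>" "C = B \<inter> S" "x \<in> B" "x \<in> S"
        unfolding restrict_partition_def by blast
      then have "C = {y \<in> S. ?f y = ?f x}" using fibre[of B x] assms(2) by blast
      then show "C \<in> ?R" using B(4) by blast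
    qed
    show "?R \<subseteq> ?L"
    proof
      fix C assume "C \<in> ?R"
      then obtain x where x: "x \<in> S" "C = {y \<in> S. ?f y = ?f x}" by blast
      then have "C = {i \<in> {1..n}. ?f i = ?f x} \<inter> S" using assms(2) by blast
      moreover have "x \<in> C" using x by blast
      ultimately show "C \<in> ?L" using block[OF x(1)] unfolding restrict_partition_def by blast
    qed
  qed
qed

text \<open>The three displayed sets are the blocks of the ranks 1, 2 and 3. Equal blocks collapse
  in the outer set, so a single formula covers all five ways in which the letters can
  coincide.\<close>

lemma standardize_triple:
  assumes "partition_on {1..n} \<pi>" "x < y" "y < z" "1 \<le> x" "z \<le> n"
    and f: "f = (\<lambda>i. rgf n \<pi> ! (i - 1))"
  shows "standardize {x, y, z} (restrict_partition \<pi> {x, y, z}) =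
    {{1} \<union> (if f x = f y then {2} else {}) \<union> (if f x = f z then {3} else {}),
     (if f x = f y then {1} else {}) \<union> {2} \<union> (if f y = f z then {3} else {}),
     (if f x = f z then {1} else {}) \<union> (if f y = f z then {2} else {}) \<union> {3}}"
proof -
  let ?S = "{x, y, z}"
  have "{i \<in> ?S. i \<le> x} = {x}" "{i \<in> ?S. i \<le> y} = {x, y}" "{i \<in> ?S. i \<le> z} = {x, y, z}"
    using assms by auto
  then have rank: "rank_in ?S x = 1" "rank_in ?S y = 2" "rank_in ?S z = 3"
    using assms by (simp_all add: rank_in_def)
  have fibre: "rank_in ?S ` {i \<in> ?S. f i = f u} =
      (if f x = f u then {1} else {}) \<union> (if f y = f u then {2} else {}) \<union> (if f z = f u then {3} else {})" for u
  proof -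
    have "{i \<in> ?S. f i = f u} =
      (if f x = f u then {x} else {}) \<union> (if f y = f u then {y} else {}) \<union> (if f z = f u then {z} else {})"
      by auto
    then show ?thesis using rank by (simp add: image_Un)
  qed
  have "?S \<subseteq> {1..n}" using assms by auto
  then have "standardize ?S (restrict_partition \<pi> ?S) = (\<lambda>u. rank_in ?S ` {i \<in> ?S. f i = f u}) ` ?S"
    by (simp only: restrict_partition_rgf[OF assms(1)] standardize_def image_image f)
  then show ?thesis unfolding fibre by (simp add: eq_commute)
qed

text \<open>\<open>contains_pattern\<close> admits any subset of the ground set. Since ranks are
  injective on \<open>S\<close>, a pattern on \<open>{1, 2, 3}\<close> forces \<open>S\<close> to
  have three elements.\<close>

lemma standardize_ground_set_card:
  assumes "partition_on {1..n} \<pi>" "S \<subseteq> {1..n}"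
  shows "card (\<Union> (standardize S (restrict_partition \<pi> S))) = card S"
proof -
  have "\<Union> (restrict_partition \<pi> S) = S"
    unfolding restrict_partition_rgf[OF assms] by auto
  then have "\<Union> (standardize S (restrict_partition \<pi> S)) = rank_in S ` S"
    by (auto simp: standardize_def)
  moreover have "inj_on (rank_in S) S"
  proof (rule linorder_inj_onI)
    fix a b assume "a < b" "a \<in> S" "b \<in> S"
    moreover have "finite S" using assms(2) finite_subset by blast
    moreover have "{y \<in> S. y \<le> a} \<subset> {y \<in> S. y \<le> b}"
    proof
      show "{y \<in> S. y \<le> a} \<subseteq> {y \<in> S. y \<le> b}" using \<open>a < b\<close> by auto
      have "b \<in> {y \<in> S. y \<le> b}" "b \<notin> {y \<in> S. y \<le> a}"
        using \<open>a < b\<close> \<open>b \<in> S\<close> by simp_all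
      then show "{y \<in> S. y \<le> a} \<noteq> {y \<in> S. y \<le> b}" by metis
    qed
    ultimately have "rank_in S a < rank_in S b"
      unfolding rank_in_def by (intro psubset_card_mono) simp_all
    then show "rank_in S a \<noteq> rank_in S b" by simp
  qed auto
  ultimately show ?thesis by (simp add: card_image)
qed

lemma card_3_ordered:
  assumes "card (S :: nat set) = 3"
  obtains x y z where "S = {x, y, z}" "x < y" "y < z"
proof -
  have "finite S" using assms card_ge_0_finite by force
  define l where "l = sorted_list_of_set S"
  have "length l = 3" "sorted_wrt (<) l" "set l = S"
    using assms \<open>finite S\<close> by (auto simp: l_def)
  then obtain x y z where "l = [x, y, z]"
    by (auto simp: numeral_3_eq_3 length_Suc_conv)
  then show thesis using that \<open>set l = S\<close> \<open>sorted_wrt (<) l\<close> by auto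
qed

text \<open>The displayed set of sets is the partition of \<open>{1, 2, 3}\<close> that records which of the letters
  \<open>a\<close>, \<open>b\<close>, \<open>c\<close> coincide.\<close>

lemma contains_pattern_iff:
  assumes "partition_on {1..n} \<pi>" "\<Union>\<omega> = {1, 2, 3}"
  shows "contains_pattern \<pi> \<omega> \<longleftrightarrow> (\<exists>a b c. subseq [a, b, c] (rgf n \<pi>) \<and>
    {{1} \<union> (if a = b then {2} else {}) \<union> (if a = c then {3} else {}),
     (if a = b then {1} else {}) \<union> {2} \<union> (if b = c then {3} else {}),
     (if a = c then {1} else {}) \<union> (if b = c then {2} else {}) \<union> {3}} = \<omega>)"
    (is "_ \<longleftrightarrow> (\<exists>a b c. _ \<and> ?K a b c = \<omega>)")
proof -
  have "\<Union>\<pi> = {1..n}" using assms(1) by (auto simp: partition_on_def)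
  note std = standardize_triple[OF assms(1) _ _ _ _ refl]
  show ?thesis
  proof
    assume "contains_pattern \<pi> \<omega>"
    then obtain S where S: "S \<subseteq> {1..n}" "standardize S (restrict_partition \<pi> S) = \<omega>"
      unfolding contains_pattern_def \<open>\<Union>\<pi> = {1..n}\<close> by blast
    then have "card S = 3" using standardize_ground_set_card[OF assms(1) S(1)] assms(2) by simp
    then obtain x y z where xyz: "S = {x, y, z}" "x < y" "y < z" by (rule card_3_ordered)
    then have "?K (rgf n \<pi> ! (x - 1)) (rgf n \<pi> ! (y - 1)) (rgf n \<pi> ! (z - 1)) = \<omega>"
      using std[of x y z] S by simp
    moreover have "subseq [rgf n \<pi> ! (x - 1), rgf n \<pi> ! (y - 1), rgf n \<pi> ! (z - 1)] (rgf n \<pi>)"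
      unfolding subseq_three_iff_nth using xyz S(1)
      by (intro exI[of _ "x - 1"] exI[of _ "y - 1"] exI[of _ "z - 1"]) auto
    ultimately show "\<exists>a b c. subseq [a, b, c] (rgf n \<pi>) \<and> ?K a b c = \<omega>" by blast
  next
    assume "\<exists>a b c. subseq [a, b, c] (rgf n \<pi>) \<and> ?K a b c = \<omega>"
    then obtain a b c where K: "subseq [a, b, c] (rgf n \<pi>)" "?K a b c = \<omega>" by blast
    then obtain i j l where ijl: "i < j" "j < l" "l < n" and
      abc: "rgf n \<pi> ! i = a" "rgf n \<pi> ! j = b" "rgf n \<pi> ! l = c"
      unfolding subseq_three_iff_nth by auto
    have "standardize {Suc i, Suc j, Suc l} (restrict_partition \<pi> {Suc i, Suc j, Suc l}) = \<omega>"
      using std[of "Suc i" "Suc j" "Suc l"] ijl K(2) abc by simp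
    moreover have "{Suc i, Suc j, Suc l} \<subseteq> \<Union>\<pi>" using ijl \<open>\<Union>\<pi> = {1..n}\<close> by auto
    ultimately show "contains_pattern \<pi> \<omega>" unfolding contains_pattern_def by blast
  qed
qed

lemma avoids_iff_subseq:
  assumes "partition_on {1..n} \<pi>"
  shows "avoids \<pi> pat_1_2_3 \<longleftrightarrow> (\<forall>a b c. subseq [a, b, c] (rgf n \<pi>) \<longrightarrow> a = b \<or> a = c \<or> b = c)"
    and "avoids \<pi> pat_1_23 \<longleftrightarrow> (\<forall>a b. subseq [a, b, b] (rgf n \<pi>) \<longrightarrow> a = b)"
    and "avoids \<pi> pat_13_2 \<longleftrightarrow> (\<forall>a b. subseq [a, b, a] (rgf n \<pi>) \<longrightarrow> a = b)"
    and "avoids \<pi> pat_12_3 \<longleftrightarrow> (\<forall>a b. subseq [a, a, b] (rgf n \<pi>) \<longrightarrow> a = b)"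
    and "avoids \<pi> pat_123 \<longleftrightarrow> (\<forall>a. \<not> subseq [a, a, a] (rgf n \<pi>))"
proof -
  let ?K = "\<lambda>a b c. {{1} \<union> (if a = b then {2} else {}) \<union> (if a = c then {3} else {}),
     (if a = b then {1} else {}) \<union> {2} \<union> (if b = c then {3} else {}),
     (if a = c then {1} else {}) \<union> (if b = c then {2} else {}) \<union> {3 :: nat}}"
  have K: "?K a b c = pat_1_2_3 \<longleftrightarrow> a \<noteq> b \<and> a \<noteq> c \<and> b \<noteq> c"
    "?K a b c = pat_1_23 \<longleftrightarrow> a \<noteq> b \<and> b = c"
    "?K a b c = pat_13_2 \<longleftrightarrow> a \<noteq> b \<and> a = c"
    "?K a b c = pat_12_3 \<longleftrightarrow> a = b \<and> a \<noteq> c"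
    "?K a b c = pat_123 \<longleftrightarrow> a = b \<and> b = c" for a b c :: nat
  proof -
    define K where "K = ?K a b c"
    \<comment> \<open>The equalities between letters can be recovered from \<open>K\<close>: two
      letters agree iff their ranks share a block. Once \<open>K\<close> is a known pattern, these
      equalities are decided by evaluation.\<close>
    have rel: "a = b \<longleftrightarrow> (\<exists>B\<in>K. 1 \<in> B \<and> 2 \<in> B)" "a = c \<longleftrightarrow> (\<exists>B\<in>K. 1 \<in> B \<and> 3 \<in> B)"
      "b = c \<longleftrightarrow> (\<exists>B\<in>K. 2 \<in> B \<and> 3 \<in> B)"
      by (auto simp: K_def)
    note pats = pat_1_2_3_def pat_1_23_def pat_13_2_def pat_12_3_def pat_123_def
    show "?K a b c = pat_1_2_3 \<longleftrightarrow> a \<noteq> b \<and> a \<noteq> c \<and> b \<noteq> c"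
      unfolding K_def[symmetric]
    proof
      assume K: "K = pat_1_2_3"
      show "a \<noteq> b \<and> a \<noteq> c \<and> b \<noteq> c" unfolding rel K pats by simp
    qed (simp add: pats K_def)
    show "?K a b c = pat_1_23 \<longleftrightarrow> a \<noteq> b \<and> b = c"
      unfolding K_def[symmetric]
    proof
      assume K: "K = pat_1_23"
      show "a \<noteq> b \<and> b = c" unfolding rel K pats by simp
    qed (auto simp: pats K_def)
    show "?K a b c = pat_13_2 \<longleftrightarrow> a \<noteq> b \<and> a = c"
      unfolding K_def[symmetric]
    proof
      assume K: "K = pat_13_2"
      show "a \<noteq> b \<and> a = c" unfolding rel K pats by simp
    qed (auto simp: pats K_def)
    show "?K a b c = pat_12_3 \<longleftrightarrow> a = b \<and> a \<noteq> c"
      unfolding K_def[symmetric]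
    proof
      assume K: "K = pat_12_3"
      show "a = b \<and> a \<noteq> c" unfolding rel K pats by simp
    qed (auto simp: pats K_def)
    show "?K a b c = pat_123 \<longleftrightarrow> a = b \<and> b = c"
      unfolding K_def[symmetric]
    proof
      assume K: "K = pat_123"
      show "a = b \<and> b = c" unfolding rel K pats by simp
    qed (auto simp: pats K_def)
  qed
  have U: "\<Union>pat_1_2_3 = {1, 2, 3}" "\<Union>pat_1_23 = {1, 2, 3}" "\<Union>pat_13_2 = {1, 2, 3}"
    "\<Union>pat_12_3 = {1, 2, 3}" "\<Union>pat_123 = {1, 2, 3}"
    by (auto simp: pat_1_2_3_def pat_1_23_def pat_13_2_def pat_12_3_def pat_123_def)
  note iff = contains_pattern_iff[OF assms]
  show "avoids \<pi> pat_1_2_3 \<longleftrightarrow> (\<forall>a b c. subseq [a, b, c] (rgf n \<pi>) \<longrightarrow> a = b \<or> a = c \<or> b = c)"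
    unfolding avoids_def iff[OF U(1)] K by blast
  show "avoids \<pi> pat_1_23 \<longleftrightarrow> (\<forall>a b. subseq [a, b, b] (rgf n \<pi>) \<longrightarrow> a = b)"
    unfolding avoids_def iff[OF U(2)] K by blast
  show "avoids \<pi> pat_13_2 \<longleftrightarrow> (\<forall>a b. subseq [a, b, a] (rgf n \<pi>) \<longrightarrow> a = b)"
    unfolding avoids_def iff[OF U(3)] K by blast
  show "avoids \<pi> pat_12_3 \<longleftrightarrow> (\<forall>a b. subseq [a, a, b] (rgf n \<pi>) \<longrightarrow> a = b)"
    unfolding avoids_def iff[OF U(4)] K by blast
  show "avoids \<pi> pat_123 \<longleftrightarrow> (\<forall>a. \<not> subseq [a, a, a] (rgf n \<pi>))"
    unfolding avoids_def iff[OF U(5)] K by blast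
qed

subsection \<open>Weakly increasing words\<close>

lemma rgf_words_Cons_1:
  assumes "w \<in> rgf_words n k" "1 \<le> k"
  obtains v where "w = 1 # v"
proof (cases w)
  case Nil
  then show thesis using assms by (simp add: rgf_words_def)
next
  case (Cons x v)
  have "{1..<x} \<subseteq> set []" using assms(1) Cons unfolding rgf_words_def by blast
  moreover have "x \<in> {1..k}" using assms(1) Cons unfolding rgf_words_def by auto
  ultimately have "x = 1" by (cases "x \<le> 1") auto
  then show thesis using that Cons by simp
qed

lemma subseq_append_irrelevant:
  "x \<notin> set u \<Longrightarrow> subseq (x # xs) (u @ v) \<longleftrightarrow> subseq (x # xs) v"
  by (induction u) auto

lemma subseq_three_set:
  assumes "subseq [a, b, c] w"
  shows "a \<in> set w" "b \<in> set w" "c \<in> set w"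
  using assms unfolding subseq_three_iff_nth by (auto intro: nth_mem order_less_trans)

lemma count_ge_2_if_subseq:
  shows "subseq [a, b, b] w \<Longrightarrow> 2 \<le> count (mset w) b"
    and "subseq [b, b, a] w \<Longrightarrow> 2 \<le> count (mset w) b"
proof -
  show "subseq [a, b, b] w \<Longrightarrow> 2 \<le> count (mset w) b"
    using subseq_Cons'[of a "[b, b]" w] unfolding subseq_two_iff .
  assume "subseq [b, b, a] w"
  moreover have "subseq [b, b] [b, b, a]" by simp
  ultimately have "subseq [b, b] w" by (rule subseq_order.trans[rotated])
  then show "2 \<le> count (mset w) b" by (simp only: subseq_two_iff)
qed

text \<open>Both copies of a letter \<open>b\<close> other than the first letter \<open>z\<close>
  come after \<open>z\<close>, and \<open>z b b\<close> is an occurrence of 1/23. The next lemma is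
  the mirror image, with \<open>b b z\<close> and the last letter.\<close>

lemma avoids_1_23_repeated:
  assumes "\<forall>a b. subseq [a, b, b] w \<longrightarrow> a = b" "w = z # v" "2 \<le> count (mset w) b"
  shows "b = z"
proof (rule ccontr)
  assume "b \<noteq> z"
  then have "subseq [b, b] v" using assms(2,3) by (simp only: subseq_two_iff) simp
  then have "subseq [z, b, b] w" using assms(2) by simp
  then show False using assms(1) \<open>b \<noteq> z\<close> by blast
qed

lemma avoids_12_3_repeated:
  assumes "\<forall>a b. subseq [a, a, b] w \<longrightarrow> a = b" "w = v @ [z]" "2 \<le> count (mset w) b"
  shows "b = z"
proof (rule ccontr)
  assume "b \<noteq> z"
  then have "subseq [b, b] v" using assms(2,3) by (simp only: subseq_two_iff) simp
  then have "subseq ([b, b] @ [z]) w" unfolding assms(2) by (rule list_emb_append_mono) simp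
  then show False using assms(1) \<open>b \<noteq> z\<close> by auto
qed

text \<open>The word starts with 1 and ends with \<open>k\<close>, so 1/23 allows only 1 to repeat
  and 12/3 only \<open>k\<close>. Conversely, sortedness puts \<open>a\<close> below 1 in
  \<open>a b b\<close> with \<open>b = 1\<close>, and \<open>b\<close> above \<open>k\<close> in
  \<open>a a b\<close> with \<open>a = k\<close>, which forces equality.\<close>

lemma sorted_avoids_iff:
  assumes w: "w \<in> rgf_words n k" "sorted w" "1 \<le> k"
  defines "N \<equiv> mset w - mset_set {1..k}"
  shows "(\<forall>a b. subseq [a, b, b] w \<longrightarrow> a = b) \<longleftrightarrow> (\<forall>b. b \<noteq> 1 \<longrightarrow> count N b = 0)"
    and "(\<forall>a b. subseq [a, a, b] w \<longrightarrow> a = b) \<longleftrightarrow> (\<forall>b. b \<noteq> k \<longrightarrow> count N b = 0)"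
    and "(\<forall>a. \<not> subseq [a, a, a] w) \<longleftrightarrow> (\<forall>b. count N b \<le> 1)"
proof -
  have set: "set w = {1..k}" using w by (simp add: rgf_words_def)
  \<comment> \<open>Truncated subtraction is exact on \<open>{1..k}\<close>, where every letter
    occurs; outside this range both counts are 0.\<close>
  have count_N: "count N b = count (mset w) b - 1" for b
  proof (cases "b \<in> {1..k}")
    case False
    then have "count (mset w) b = 0" using set by (simp only: count_mset_0_iff) simp
    then show ?thesis unfolding N_def count_diff by linarith
  qed (simp add: N_def)
  have mono: "a \<le> b \<and> b \<le> c" if "subseq [a, b, c] w" for a b c
    using that w(2) unfolding subseq_three_iff_nth
    by (metis less_imp_le_nat order_less_trans sorted_nth_mono)
  obtain v where v: "w = 1 # v" using rgf_words_Cons_1[OF w(1,3)] .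
  obtain u z where u: "w = u @ [z]" using v by (metis list.distinct(1) rev_exhaust)
  have "k \<in> set w" unfolding set using w(3) by simp
  then have "k \<le> z" using w(2) unfolding u by (auto simp: sorted_append)
  moreover have "z \<in> set w" unfolding u by simp
  ultimately have z: "z = k" unfolding set by simp
  show "(\<forall>a b. subseq [a, b, b] w \<longrightarrow> a = b) \<longleftrightarrow> (\<forall>b. b \<noteq> 1 \<longrightarrow> count N b = 0)" (is "?L \<longleftrightarrow> ?R")
  proof
    assume ?L
    note rep = avoids_1_23_repeated[OF this v]
    show ?R
    proof (intro allI impI)
      fix b :: nat assume "b \<noteq> 1"
      then show "count N b = 0" using rep[of b] unfolding count_N by linarith
    qed
  next
    assume R: ?R
    show ?L
    proof (intro allI impI, rule ccontr)
      fix a b assume ab: "subseq [a, b, b] w" "a \<noteq> b"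
      then have "b = 1" using R count_ge_2_if_subseq(1) count_N by fastforce
      then have "a \<le> 1" using mono[OF ab(1)] by simp
      then show False using subseq_three_set(1)[OF ab(1)] set \<open>b = 1\<close> ab(2) by simp
    qed
  qed
  show "(\<forall>a b. subseq [a, a, b] w \<longrightarrow> a = b) \<longleftrightarrow> (\<forall>b. b \<noteq> k \<longrightarrow> count N b = 0)" (is "?L \<longleftrightarrow> ?R")
  proof
    assume ?L
    note rep = avoids_12_3_repeated[OF this u, unfolded z]
    show ?R
    proof (intro allI impI)
      fix b :: nat assume "b \<noteq> k"
      then show "count N b = 0" using rep[of b] unfolding count_N by linarith
    qed
  next
    assume R: ?R
    show ?L
    proof (intro allI impI, rule ccontr)
      fix a b assume ab: "subseq [a, a, b] w" "a \<noteq> b"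
      then have "a = k" using R count_ge_2_if_subseq(2) count_N by fastforce
      then have "k \<le> b" using mono[OF ab(1)] by simp
      then show False using subseq_three_set(3)[OF ab(1)] set \<open>a = k\<close> ab(2) by simp
    qed
  qed
  show "(\<forall>a. \<not> subseq [a, a, a] w) \<longleftrightarrow> (\<forall>b. count N b \<le> 1)"
    unfolding subseq_three_iff count_N by (intro iff_allI) linarith
qed

section \<open>Generating functions as sums over words and over multisets\<close>

definition weight :: "'a \<Rightarrow> 'a \<Rightarrow> 'a \<Rightarrow> 'a \<Rightarrow> nat list \<Rightarrow> 'a :: comm_semiring_1" where
  "weight q r s t w = q ^ lb w * r ^ ls w * s ^ rb w * t ^ rs w"

lemma F_eq_sum_words:
  assumes "\<And>\<pi>. partition_on {1..n} \<pi> \<Longrightarrow> card \<pi> = k \<Longrightarrow> (\<forall>\<omega>\<in>P. avoids \<pi> \<omega>) \<longleftrightarrow> Q (rgf n \<pi>)"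
  shows "F n k P q r s t = (\<Sum>w | w \<in> rgf_words n k \<and> Q w. weight q r s t w)"
proof -
  let ?A = "{\<pi>. partition_on {1..n} \<pi> \<and> card \<pi> = k}"
  have av: "avoiders n k P = {\<pi> \<in> ?A. Q (rgf n \<pi>)}"
    using assms by (auto simp: avoiders_def)
  have img: "rgf n ` ?A = rgf_words n k" using bij_betw_rgf by (rule bij_betw_imp_surj_on)
  have "rgf n ` avoiders n k P = {w \<in> rgf n ` ?A. Q w}"
    unfolding av by blast
  also have "\<dots> = {w. w \<in> rgf_words n k \<and> Q w}" unfolding img by simp
  finally have "bij_betw (rgf n) (avoiders n k P) {w. w \<in> rgf_words n k \<and> Q w}"
    using inj_on_subset[OF rgf_inj, of "avoiders n k P" n k] av by (auto intro: bij_betw_imageI)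
  then show ?thesis
    unfolding F_def weight_def[symmetric] by (rule sum.reindex_bij_betw)
qed

lemma weight_sorted:
  assumes "sorted w" "set w = {1..k}"
  shows "weight q r s t w = r ^ (\<Sum>x\<in>#mset w. x - 1) * s ^ (\<Sum>x\<in>#mset w. k - x)"
proof -
  have "ls w = (\<Sum>x\<leftarrow>w. x - 1)"
    by (rule ls_rgf_words[OF sorted_in_rgf_words[OF assms refl]])
  then show ?thesis
    unfolding weight_def lb_sorted[OF assms(1)] rs_sorted[OF assms(1)] rb_sorted[OF assms]
    by (simp flip: sum_mset_sum_list mset_map)
qed

lemma sum_pred_eq_choose_two: "(\<Sum>x = 1..k. x - 1) = k choose 2"
  by (induction k) (simp_all add: numeral_2_eq_2)

lemma sum_codiff_eq_choose_two: "(\<Sum>x = 1..k. k - x) = k choose 2"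
proof -
  have "(\<Sum>x = 1..k. k - x) = (\<Sum>x = 1..k. x - 1)"
    by (rule sum.reindex_bij_witness[of _ "\<lambda>x. Suc k - x" "\<lambda>x. Suc k - x"]) auto
  then show ?thesis by (simp only: sum_pred_eq_choose_two)
qed

text \<open>A sorted word is the sorted listing of its letters, and each of 1, ..., k occurs.
  Splitting off one copy of each leaves an arbitrary multiset \<open>N\<close> of
  \<open>n - k\<close> letters; the removed copies contribute \<open>k choose 2\<close> to
  \<open>ls\<close> and to \<open>rb\<close>.\<close>

lemma sum_sorted_rgf_words:
  assumes "k \<le> n"
  shows "(\<Sum>w | w \<in> rgf_words n k \<and> sorted w \<and> Q (mset w - mset_set {1..k}). weight q r s t w)
    = (\<Sum>N | set_mset N \<subseteq> {1..k} \<and> size N = n - k \<and> Q N.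
        r ^ ((k choose 2) + (\<Sum>x\<in>#N. x - 1)) * s ^ ((k choose 2) + (\<Sum>x\<in>#N. k - x)))"
    (is "sum _ ?A = sum ?g ?B")
proof -
  let ?M = "mset_set {1..k}"
  have M: "?M \<subseteq># mset w" if "w \<in> rgf_words n k" for w
    using that mset_set_set_mset_msubset[of "mset w"] by (simp add: rgf_words_def)
  have *: "sorted_list_of_multiset (?M + N) \<in> rgf_words n k"
    if "set_mset N \<subseteq> {1..k}" "size N = n - k" for N
  proof (rule sorted_in_rgf_words)
    show "set (sorted_list_of_multiset (?M + N)) = {1..k}" using that by auto
    have "size (?M + N) = n" using that assms by simp
    then show "length (sorted_list_of_multiset (?M + N)) = n"
      by (metis mset_sorted_list_of_multiset size_mset)
  qed simp
  show ?thesis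
  proof (rule sum.reindex_bij_witness[where i = "\<lambda>N. sorted_list_of_multiset (?M + N)"
        and j = "\<lambda>w. mset w - ?M"])
    fix w assume w: "w \<in> ?A"
    then show "sorted_list_of_multiset (?M + (mset w - ?M)) = w"
      using M[of w] by (simp add: sorted_sort_id)
    show "mset w - ?M \<in> ?B"
      using w M[of w] by (auto simp: rgf_words_def size_Diff_submset dest: in_diffD)
    define N where "N = mset w - ?M"
    have eq: "mset w = ?M + N" using w M[of w] by (simp add: N_def)
    have split: "(\<Sum>x\<in>#mset w. f x) = (\<Sum>x = 1..k. f x) + (\<Sum>x\<in>#N. f x)" for f :: "nat \<Rightarrow> nat"
      unfolding eq image_mset_union sum_mset.union sum_unfold_sum_mset ..
    have "sorted w" "set w = {1..k}" using w by (simp_all add: rgf_words_def)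
    then show "?g (mset w - ?M) = weight q r s t w"
      by (simp only: weight_sorted split sum_pred_eq_choose_two sum_codiff_eq_choose_two N_def)
  next
    fix N assume N: "N \<in> ?B"
    then show "mset (sorted_list_of_multiset (?M + N)) - ?M = N" by simp
    then show "sorted_list_of_multiset (?M + N) \<in> ?A" using N * by simp
  qed
qed

lemma rgf_words_1:
  assumes "1 \<le> n"
  shows "rgf_words n 1 = {replicate n 1}"
proof
  show "rgf_words n 1 \<subseteq> {replicate n 1}"
  proof
    fix w assume "w \<in> rgf_words n 1"
    then show "w \<in> {replicate n 1}"
      using replicate_eqI[of w n 1] by (simp add: rgf_words_def)
  qed
  have "replicate n 1 \<in> rgf_words n 1"
    using assms by (intro sorted_in_rgf_words) (simp_all add: sorted_replicate)
  then show "{replicate n 1} \<subseteq> rgf_words n 1" by simp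
qed

lemma weight_replicate:
  assumes "1 \<le> n"
  shows "weight q r s t (replicate n 1) = 1"
proof -
  have "sorted (replicate n (1::nat))" "set (replicate n 1) = {1..1::nat}"
    using assms by (simp_all add: sorted_replicate)
  from weight_sorted[OF this, of q r s t] show ?thesis by (simp add: sum_mset_sum_list flip: mset_map)
qed

text \<open>Since 13/2 lies in \<open>P\<close>, only sorted words survive. The remaining patterns
  thus have to be translated for sorted words alone, and in terms of the surplus.\<close>

lemma F_sorted:
  assumes "1 \<le> k" "k \<le> n" "pat_13_2 \<in> P"
    and "\<And>\<pi>. partition_on {1..n} \<pi> \<Longrightarrow> card \<pi> = k \<Longrightarrow> sorted (rgf n \<pi>) \<Longrightarrow>
      (\<forall>\<omega>\<in>P. avoids \<pi> \<omega>) \<longleftrightarrow> Q (mset (rgf n \<pi>) - mset_set {1..k})"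
  shows "F n k P q r s t = (\<Sum>N | set_mset N \<subseteq> {1..k} \<and> size N = n - k \<and> Q N.
        r ^ ((k choose 2) + (\<Sum>x\<in>#N. x - 1)) * s ^ ((k choose 2) + (\<Sum>x\<in>#N. k - x)))"
proof -
  have "(\<forall>\<omega>\<in>P. avoids \<pi> \<omega>) \<longleftrightarrow> sorted (rgf n \<pi>) \<and> Q (mset (rgf n \<pi>) - mset_set {1..k})"
    if \<pi>: "partition_on {1..n} \<pi>" "card \<pi> = k" for \<pi>
  proof -
    have "avoids \<pi> pat_13_2 \<longleftrightarrow> sorted (rgf n \<pi>)"
      unfolding avoids_iff_subseq(3)[OF \<pi>(1)] sorted_iff_avoids_13_2[OF rgf_in_rgf_words[OF \<pi>(1)]]
      by blast
    then show ?thesis using assms(3,4) \<pi> by metis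
  qed
  then have "F n k P q r s t = (\<Sum>w | w \<in> rgf_words n k \<and> sorted w \<and> Q (mset w - mset_set {1..k}).
      weight q r s t w)"
    by (rule F_eq_sum_words)
  then show ?thesis by (simp only: sum_sorted_rgf_words[OF assms(2)])
qed

lemma multisets_constant:
  assumes "c \<in> A"
  shows "{N. set_mset N \<subseteq> A \<and> size N = m \<and> (\<forall>b. b \<noteq> c \<longrightarrow> count N b = 0)} = {replicate_mset m c}"
    (is "?L = ?R")
proof
  show "?L \<subseteq> ?R"
  proof
    fix N assume N: "N \<in> ?L"
    then have "N = replicate_mset (count N c) c"
      by (intro multiset_eqI) (simp add: count_replicate_mset)
    moreover from this have "size N = count N c" by (metis size_replicate_mset)
    ultimately show "N \<in> ?R" using N by simp
  qed
  show "?R \<subseteq> ?L" using assms by (auto simp: count_replicate_mset)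
qed

text \<open>This reads the exponent of the theorem as the constant part plus \<open>n - k\<close>
  surplus letters contributing \<open>k - 1\<close> each.\<close>

lemma two_n_minus_k_div:
  assumes "1 \<le> k" "k \<le> n"
  shows "(k - 1) * (2 * n - k) div 2 = (k choose 2) + (n - k) * (k - 1)"
proof -
  obtain d where d: "n = k + d" using assms le_Suc_ex by blast
  have "(k - 1) * (2 * n - k) = k * (k - 1) + (d * (k - 1)) * 2"
    unfolding d by (simp add: algebra_simps)
  then show ?thesis unfolding choose_two d by simp
qed

text \<open>Every surplus letter is 1, adding 0 to \<open>ls\<close> and \<open>k - 1\<close> to
  \<open>rb\<close>. In \<open>F_13_2_12_3\<close> every surplus letter is \<open>k\<close>, which
  exchanges the two statistics.\<close>

lemma F_1_23_13_2:
  assumes "1 \<le> k" "k \<le> n"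
  shows "F n k {pat_1_23, pat_13_2} q r s t
    = r ^ (k * (k - 1) div 2) * s ^ ((k - 1) * (2 * n - k) div 2)"
proof -
  have "F n k {pat_1_23, pat_13_2} q r s t = (\<Sum>N | set_mset N \<subseteq> {1..k} \<and> size N = n - k \<and>
      (\<forall>b. b \<noteq> 1 \<longrightarrow> count N b = 0).
      r ^ ((k choose 2) + (\<Sum>x\<in>#N. x - 1)) * s ^ ((k choose 2) + (\<Sum>x\<in>#N. k - x)))"
  proof (rule F_sorted[OF assms])
    fix \<pi> assume \<pi>: "partition_on {1..n} \<pi>" "card \<pi> = k" "sorted (rgf n \<pi>)"
    then have rgf: "rgf n \<pi> \<in> rgf_words n k" using rgf_in_rgf_words by blast
    have "avoids \<pi> pat_13_2"
      using \<pi> sorted_iff_avoids_13_2[OF rgf] avoids_iff_subseq(3)[OF \<pi>(1)] by blast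
    then show "(\<forall>\<omega>\<in>{pat_1_23, pat_13_2}. avoids \<pi> \<omega>) \<longleftrightarrow>
        (\<forall>b. b \<noteq> 1 \<longrightarrow> count (mset (rgf n \<pi>) - mset_set {1..k}) b = 0)"
      using avoids_iff_subseq(2)[OF \<pi>(1)] sorted_avoids_iff(1)[OF rgf \<pi>(3) assms(1)] by simp
  qed simp
  also have "\<dots> = r ^ (k choose 2) * s ^ ((k choose 2) + (n - k) * (k - 1))"
    using assms by (subst multisets_constant) simp_all
  finally show ?thesis using two_n_minus_k_div[OF assms] by (simp add: choose_two)
qed

lemma F_13_2_12_3:
  assumes "1 \<le> k" "k \<le> n"
  shows "F n k {pat_13_2, pat_12_3} q r s t
    = r ^ ((k - 1) * (2 * n - k) div 2) * s ^ ((k - 1) * k div 2)"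
proof -
  have "F n k {pat_13_2, pat_12_3} q r s t = (\<Sum>N | set_mset N \<subseteq> {1..k} \<and> size N = n - k \<and>
      (\<forall>b. b \<noteq> k \<longrightarrow> count N b = 0).
      r ^ ((k choose 2) + (\<Sum>x\<in>#N. x - 1)) * s ^ ((k choose 2) + (\<Sum>x\<in>#N. k - x)))"
  proof (rule F_sorted[OF assms])
    fix \<pi> assume \<pi>: "partition_on {1..n} \<pi>" "card \<pi> = k" "sorted (rgf n \<pi>)"
    then have rgf: "rgf n \<pi> \<in> rgf_words n k" using rgf_in_rgf_words by blast
    have "avoids \<pi> pat_13_2"
      using \<pi> sorted_iff_avoids_13_2[OF rgf] avoids_iff_subseq(3)[OF \<pi>(1)] by blast
    then show "(\<forall>\<omega>\<in>{pat_13_2, pat_12_3}. avoids \<pi> \<omega>) \<longleftrightarrow>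
        (\<forall>b. b \<noteq> k \<longrightarrow> count (mset (rgf n \<pi>) - mset_set {1..k}) b = 0)"
      using avoids_iff_subseq(4)[OF \<pi>(1)] sorted_avoids_iff(2)[OF rgf \<pi>(3) assms(1)] by simp
  qed simp
  also have "\<dots> = r ^ ((k choose 2) + (n - k) * (k - 1)) * s ^ (k choose 2)"
    using assms by (subst multisets_constant) simp_all
  finally show ?thesis using two_n_minus_k_div[OF assms] by (simp add: choose_two mult.commute)
qed

text \<open>A multiset with multiplicities at most one is a set, so \<open>L\<close> is the set of
  letters occurring twice.\<close>

lemma F_13_2_123:
  assumes "1 \<le> k" "k \<le> n"
  shows "F n k {pat_13_2, pat_123} q r s t
    = (\<Sum>L | L \<subseteq> {1..k} \<and> card L = n - k.
         r ^ ((k choose 2) + (\<Sum>l\<in>L. l - 1)) * s ^ ((k choose 2) + (\<Sum>l\<in>L. k - l)))"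
proof -
  have "F n k {pat_13_2, pat_123} q r s t = (\<Sum>N | set_mset N \<subseteq> {1..k} \<and> size N = n - k \<and>
      (\<forall>b. count N b \<le> 1).
      r ^ ((k choose 2) + (\<Sum>x\<in>#N. x - 1)) * s ^ ((k choose 2) + (\<Sum>x\<in>#N. k - x)))"
  proof (rule F_sorted[OF assms])
    fix \<pi> assume \<pi>: "partition_on {1..n} \<pi>" "card \<pi> = k" "sorted (rgf n \<pi>)"
    then have rgf: "rgf n \<pi> \<in> rgf_words n k" using rgf_in_rgf_words by blast
    have "avoids \<pi> pat_13_2"
      using \<pi> sorted_iff_avoids_13_2[OF rgf] avoids_iff_subseq(3)[OF \<pi>(1)] by blast
    then show "(\<forall>\<omega>\<in>{pat_13_2, pat_123}. avoids \<pi> \<omega>) \<longleftrightarrow>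
        (\<forall>b. count (mset (rgf n \<pi>) - mset_set {1..k}) b \<le> 1)"
      using avoids_iff_subseq(5)[OF \<pi>(1)] sorted_avoids_iff(3)[OF rgf \<pi>(3) assms(1)] by simp
  qed simp
  also have "\<dots> = (\<Sum>L | L \<subseteq> {1..k} \<and> card L = n - k.
         r ^ ((k choose 2) + (\<Sum>l\<in>L. l - 1)) * s ^ ((k choose 2) + (\<Sum>l\<in>L. k - l)))"
  proof (rule sum.reindex_bij_witness[where i = mset_set and j = set_mset])
    fix N assume N: "N \<in> {N. set_mset N \<subseteq> {1..k} \<and> size N = n - k \<and> (\<forall>b. count N b \<le> 1)}"
    show eq: "mset_set (set_mset N) = N"
    proof (rule multiset_eqI)
      fix b
      have "count N b \<le> 1" using N by simp
      then show "count (mset_set (set_mset N)) b = count N b"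
        by (cases "b \<in># N") (auto simp: count_eq_zero_iff le_Suc_eq)
    qed
    show "set_mset N \<in> {L. L \<subseteq> {1..k} \<and> card L = n - k}"
      using N arg_cong[OF eq, of size] by simp
    show "r ^ ((k choose 2) + (\<Sum>l\<in>set_mset N. l - 1)) * s ^ ((k choose 2) + (\<Sum>l\<in>set_mset N. k - l))
        = r ^ ((k choose 2) + (\<Sum>x\<in>#N. x - 1)) * s ^ ((k choose 2) + (\<Sum>x\<in>#N. k - x))"
      unfolding sum_unfold_sum_mset eq ..
  next
    fix L assume L: "L \<in> {L. L \<subseteq> {1..k} \<and> card L = n - k}"
    then have "finite L" by (auto intro: finite_subset)
    then show "set_mset (mset_set L) = L" by simp
    have "count (mset_set L) b \<le> 1" for b by (simp add: count_mset_set')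
    then show "mset_set L \<in> {N. set_mset N \<subseteq> {1..k} \<and> size N = n - k \<and> (\<forall>b. count N b \<le> 1)}"
      using L \<open>finite L\<close> by simp
  qed
  finally show ?thesis .
qed

lemma avoids_1_2_3_two_blocks:
  assumes "partition_on {1..n} \<pi>" "card \<pi> \<le> 2"
  shows "avoids \<pi> pat_1_2_3"
  unfolding avoids_iff_subseq(1)[OF assms(1)]
proof (intro allI impI)
  fix a b c assume abc: "subseq [a, b, c] (rgf n \<pi>)"
  have "set (rgf n \<pi>) = {1..card \<pi>}"
    using rgf_in_rgf_words[OF assms(1)] by (simp add: rgf_words_def)
  then have "a \<in> {1..card \<pi>}" "b \<in> {1..card \<pi>}" "c \<in> {1..card \<pi>}"
    using subseq_three_set[OF abc] by simp_all
  then show "a = b \<or> a = c \<or> b = c" using assms(2) by simp linarith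
qed

lemma F_1_2_3_13_2:
  assumes "2 \<le> n"
  shows "F n 2 {pat_1_2_3, pat_13_2} q r s t = (\<Sum>i = 1..n - 1. r ^ i * s ^ (n - i))"
proof -
  have "F n 2 {pat_1_2_3, pat_13_2} q r s t = (\<Sum>N | set_mset N \<subseteq> {1..2} \<and> size N = n - 2 \<and> True.
      r ^ ((2 choose 2) + (\<Sum>x\<in>#N. x - 1)) * s ^ ((2 choose 2) + (\<Sum>x\<in>#N. 2 - x)))"
  proof (rule F_sorted[OF _ assms])
    fix \<pi> assume \<pi>: "partition_on {1..n} \<pi>" "card \<pi> = 2" "sorted (rgf n \<pi>)"
    then have rgf: "rgf n \<pi> \<in> rgf_words n 2" using rgf_in_rgf_words by metis
    have "avoids \<pi> pat_13_2"
      using \<pi> sorted_iff_avoids_13_2[OF rgf] avoids_iff_subseq(3)[OF \<pi>(1)] by blast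
    then show "(\<forall>\<omega>\<in>{pat_1_2_3, pat_13_2}. avoids \<pi> \<omega>) \<longleftrightarrow> True"
      using avoids_1_2_3_two_blocks[OF \<pi>(1)] \<pi>(2) by simp
  qed simp_all
  also have "\<dots> = (\<Sum>i = 1..n - 1. r ^ i * s ^ (n - i))"
  \<comment> \<open>The index \<open>i\<close> is the number of letters 2 in the word: one
    obligatory copy and the surplus ones. The remaining \<open>n - i\<close> letters are 1.\<close>
  proof (rule sum.reindex_bij_witness[where j = "\<lambda>N. Suc (count N 2)"
        and i = "\<lambda>i. replicate_mset (n - 1 - i) 1 + replicate_mset (i - 1) (2 :: nat)"])
    fix N assume N: "N \<in> {N :: nat multiset. set_mset N \<subseteq> {1..2} \<and> size N = n - 2 \<and> True}"
    have eq: "N = replicate_mset (count N 1) 1 + replicate_mset (count N 2) 2"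
    proof (rule multiset_eqI)
      fix b
      have "b \<notin># N" if "b \<noteq> 1" "b \<noteq> 2" using N that by force
      then show "count N b = count (replicate_mset (count N 1) 1 + replicate_mset (count N 2) 2) b"
        by (auto simp: count_replicate_mset count_eq_zero_iff)
    qed
    have size: "count N 1 + count N 2 = n - 2"
      using N arg_cong[OF eq, of size] by simp
    then have 1: "count N 1 = n - 1 - Suc (count N 2)" using assms by linarith
    show "replicate_mset (n - 1 - Suc (count N 2)) 1 + replicate_mset (Suc (count N 2) - 1) 2 = N"
      using eq unfolding 1 by simp
    show "Suc (count N 2) \<in> {1..n - 1}" using size assms by simp
    have sums: "(\<Sum>x\<in>#N. x - 1) = count N 2" "(\<Sum>x\<in>#N. 2 - x) = count N 1"
      by (subst eq, simp)+
    show "r ^ Suc (count N 2) * s ^ (n - Suc (count N 2))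
      = r ^ ((2 choose 2) + (\<Sum>x\<in>#N. x - 1)) * s ^ ((2 choose 2) + (\<Sum>x\<in>#N. 2 - x))"
    proof -
      have "n - Suc (count N 2) = Suc (count N 1)" using size assms by linarith
      then show ?thesis unfolding sums by simp
    qed
  next
    fix i assume i: "i \<in> {1..n - 1}"
    then show "Suc (count (replicate_mset (n - 1 - i) 1 + replicate_mset (i - 1) (2 :: nat)) 2) = i"
      by simp
    show "replicate_mset (n - 1 - i) 1 + replicate_mset (i - 1) (2 :: nat)
      \<in> {N :: nat multiset. set_mset N \<subseteq> {1..2} \<and> size N = n - 2 \<and> True}"
      using i by (auto split: if_splits)
  qed
  finally show ?thesis .
qed

section \<open>The extreme cases of one block and of n blocks\<close>

lemma F_one_block:
  assumes "1 \<le> n" "P \<subseteq> {pat_1_2_3, pat_1_23, pat_13_2, pat_12_3}"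
  shows "F n 1 P q r s t = 1"
proof -
  have "F n 1 P q r s t = (\<Sum>w | w \<in> rgf_words n 1 \<and> True. weight q r s t w)"
  proof (rule F_eq_sum_words)
    fix \<pi> assume \<pi>: "partition_on {1..n} \<pi>" "card \<pi> = 1"
    then have "rgf n \<pi> \<in> rgf_words n 1" using rgf_in_rgf_words by metis
    then have "set (rgf n \<pi>) = {1}" by (simp add: rgf_words_def)
    then have "a = 1 \<and> b = 1 \<and> c = 1" if "subseq [a, b, c] (rgf n \<pi>)" for a b c
      using subseq_three_set[OF that] by simp
    then have "avoids \<pi> pat_1_2_3" "avoids \<pi> pat_1_23" "avoids \<pi> pat_13_2" "avoids \<pi> pat_12_3"
      unfolding avoids_iff_subseq[OF \<pi>(1)] by metis+
    then show "(\<forall>\<omega>\<in>P. avoids \<pi> \<omega>) \<longleftrightarrow> True" using assms(2) by blast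
  qed
  also have "\<dots> = 1" using rgf_words_1[OF assms(1)] weight_replicate[OF assms(1)] by simp
  finally show ?thesis .
qed

lemma subseq_three_distinct:
  assumes "subseq [a, b, c] w" "distinct w"
  shows "a \<noteq> b \<and> b \<noteq> c \<and> a \<noteq> c"
proof -
  obtain i j l where "i < j" "j < l" "l < length w" "w ! i = a" "w ! j = b" "w ! l = c"
    using assms(1) unfolding subseq_three_iff_nth by blast
  then show ?thesis using nth_eq_iff_index_eq[OF assms(2)] by auto
qed

text \<open>With \<open>n\<close> values on \<open>n\<close> positions no letter repeats. Then no
  subword \<open>a b a\<close> exists, and the criterion for 13/2 makes the word sorted.\<close>

lemma rgf_words_full: "rgf_words n n = {[1..<Suc n]}"
proof
  show "rgf_words n n \<subseteq> {[1..<Suc n]}"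
  proof
    fix w assume w: "w \<in> rgf_words n n"
    then have "length w = n" "set w = {1..n}" by (simp_all add: rgf_words_def)
    then have "distinct w" by (simp add: card_distinct)
    have "sorted w"
      unfolding sorted_iff_avoids_13_2[OF w]
    proof clarify
      fix a b assume "subseq [a, b, a] w"
      then show False using subseq_three_distinct[OF _ \<open>distinct w\<close>] by blast
    qed
    moreover have "set w = set [1..<Suc n]"
      using \<open>set w = _\<close> by (simp add: atLeastLessThanSuc_atLeastAtMost del: upt_Suc)
    ultimately have "w = [1..<Suc n]"
      using \<open>distinct w\<close> by (intro sorted_distinct_set_unique) (simp_all del: upt_Suc)
    then show "w \<in> {[1..<Suc n]}" by simp
  qed
  have "[1..<Suc n] \<in> rgf_words n n"
    by (intro sorted_in_rgf_words) (simp_all add: atLeastLessThanSuc_atLeastAtMost del: upt_Suc)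
  then show "{[1..<Suc n]} \<subseteq> rgf_words n n" by simp
qed

lemma F_n_blocks:
  assumes "P \<subseteq> {pat_1_23, pat_13_2, pat_12_3, pat_123}"
  shows "F n n P q r s t = (r * s) ^ (n choose 2)"
proof -
  let ?w = "[1..<Suc n]"
  have mset: "mset ?w = mset_set {1..n}"
    by (simp add: atLeastLessThanSuc_atLeastAtMost del: upt_Suc)
  have "F n n P q r s t = (\<Sum>w | w \<in> rgf_words n n \<and> True. weight q r s t w)"
  proof (rule F_eq_sum_words)
    fix \<pi> assume \<pi>: "partition_on {1..n} \<pi>" "card \<pi> = n"
    then have "rgf n \<pi> \<in> rgf_words n n" using rgf_in_rgf_words by metis
    then have w: "rgf n \<pi> = ?w" by (simp only: rgf_words_full singleton_iff)
    have "a \<noteq> b \<and> b \<noteq> c \<and> a \<noteq> c" if "subseq [a, b, c] ?w" for a b c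
      using subseq_three_distinct[OF that distinct_upt] .
    then have "avoids \<pi> pat_1_23" "avoids \<pi> pat_13_2" "avoids \<pi> pat_12_3" "avoids \<pi> pat_123"
      unfolding avoids_iff_subseq[OF \<pi>(1)] w by metis+
    then show "(\<forall>\<omega>\<in>P. avoids \<pi> \<omega>) \<longleftrightarrow> True" using assms by blast
  qed
  also have "\<dots> = weight q r s t ?w" by (simp add: rgf_words_full)
  also have "\<dots> = r ^ (n choose 2) * s ^ (n choose 2)"
  proof -
    have "sorted ?w" "set ?w = {1..n}"
      by (simp_all add: atLeastLessThanSuc_atLeastAtMost del: upt_Suc)
    note weight_sorted[OF this, of q r s t]
    then show ?thesis
      unfolding mset by (simp only: sum_unfold_sum_mset[symmetric] sum_pred_eq_choose_two sum_codiff_eq_choose_two)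
  qed
  finally show ?thesis by (simp add: power_mult_distrib)
qed

subsection \<open>Words with exactly one repeated letter\<close>

definition ins_word :: "nat \<Rightarrow> nat \<Rightarrow> nat \<Rightarrow> nat list" where
  "ins_word n m a = [1..<Suc m] @ a # [Suc m..<n]"

text \<open>An entry \<open>x\<close> of the run sees the values below \<open>j\<close> in the rest
  of the run and the values from \<open>j\<close> to \<open>k\<close> in \<open>v\<close>.\<close>

lemma rb_upt_append:
  assumes "set v \<subseteq> {..k}" "{j..k} \<subseteq> set v" "j \<le> Suc k"
  shows "rb ([i..<j] @ v) = (\<Sum>x\<leftarrow>[i..<j]. k - x) + rb v"
proof (cases "i \<le> j")
  case True
  then show ?thesis
  proof (induction rule: inc_induct)
    case (step i)
    have "{y \<in> set ([Suc i..<j] @ v). i < y} = {i<..k}"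
    proof (intro set_eqI iffI)
      fix y assume "y \<in> {y \<in> set ([Suc i..<j] @ v). i < y}"
      then show "y \<in> {i<..k}" using assms(1,3) by auto
    next
      fix y assume "y \<in> {i<..k}"
      then show "y \<in> {y \<in> set ([Suc i..<j] @ v). i < y}"
        using assms(2) by (cases "y < j") auto
    qed
    then have "rb (i # ([Suc i..<j] @ v)) = (k - i) + rb ([Suc i..<j] @ v)"
      by (simp only: rb_Cons card_greaterThanAtMost add.commute)
    then show ?case using step by (simp add: upt_conv_Cons del: upt_Suc)
  qed simp
qed simp

text \<open>The deleted \<open>y\<close> has an earlier occurrence in \<open>p\<close>, so the set
  of values before any remaining letter is unchanged.\<close>

lemma rgf_words_delete:
  assumes "p @ y # v \<in> rgf_words (Suc n) k" "y \<in> set p"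
  shows "p @ v \<in> rgf_words n k"
proof -
  have split: "{1..<x} \<subseteq> set u" if "p @ y # v = u @ x # v'" for u x v'
    using assms(1) that unfolding rgf_words_def by blast
  have "{1..<x} \<subseteq> set u" if eq: "p @ v = u @ x # v'" for u x v'
  proof -
    consider us where "p = u @ us" "us @ v = x # v'" | us where "p @ us = u" "v = us @ x # v'"
      using eq append_eq_append_conv2[of p v u "x # v'"] by blast
    then show ?thesis
    proof cases
      case 1
      show ?thesis
      proof (cases us)
        case Nil
        then show ?thesis using split[of "p @ [y]" x v'] 1 assms(2) by auto
      next
        case (Cons z us')
        then show ?thesis using split[of u x "us' @ y # v"] 1 by simp
      qed
    next
      case 2
      then show ?thesis using split[of "p @ y # us" x v'] assms(2) by auto
    qed
  qed
  moreover have "length (p @ v) = n" "set (p @ v) = {1..k}"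
    using assms unfolding rgf_words_def by auto
  ultimately show ?thesis unfolding rgf_words_def by blast
qed

lemma rgf_words_insert:
  assumes "p @ v \<in> rgf_words n k" "y \<in> set p"
  shows "p @ y # v \<in> rgf_words (Suc n) k"
proof -
  have split: "{1..<x} \<subseteq> set u" if "p @ v = u @ x # v'" for u x v'
    using assms(1) that unfolding rgf_words_def by blast
  \<comment> \<open>The inserted copy inherits its smaller predecessors from the occurrence of
    \<open>y\<close> already in \<open>p\<close>.\<close>
  have y: "{1..<y} \<subseteq> set p"
  proof -
    obtain p1 p2 where "p = p1 @ y # p2" using split_list[OF assms(2)] by blast
    then show ?thesis using split[of p1 y "p2 @ v"] by auto
  qed
  have "{1..<x} \<subseteq> set u" if eq: "p @ y # v = u @ x # v'" for u x v'
  proof -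
    consider us where "p = u @ us" "us @ y # v = x # v'" | us where "p @ us = u" "y # v = us @ x # v'"
      using eq append_eq_append_conv2[of p "y # v" u "x # v'"] by blast
    then show ?thesis
    proof cases
      case 1
      show ?thesis
      proof (cases us)
        case Nil
        then show ?thesis using y 1 by simp
      next
        case (Cons z us')
        then show ?thesis using split[of u x "us' @ v"] 1 by simp
      qed
    next
      case 2
      show ?thesis
      proof (cases us)
        case Nil
        then show ?thesis using y 2 by simp
      next
        case (Cons z us')
        then show ?thesis using split[of "p @ us'" x v'] 2 by auto
      qed
    qed
  qed
  moreover have "length (p @ y # v) = Suc n" "set (p @ y # v) = {1..k}"
    using assms unfolding rgf_words_def by auto
  ultimately show ?thesis unfolding rgf_words_def by blast
qed

lemma upt_split: "m < n \<Longrightarrow> [1..<Suc m] @ [Suc m..<n] = [1..<n]"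
  by (metis Suc_leI le_add1 plus_1_eq_Suc upt_add_eq_append le_add_diff_inverse)

text \<open>Deleting the second occurrence of the repeated letter leaves a word with \<open>n - 1\<close> distinct
  letters, which can only be \<open>1 ... (n-1)\<close>.\<close>

lemma rgf_words_one_less:
  assumes "2 \<le> n"
  shows "rgf_words n (n - 1) = {ins_word n m a | m a. 1 \<le> a \<and> a \<le> m \<and> m \<le> n - 1}"
proof (intro set_eqI iffI)
  fix w assume w: "w \<in> rgf_words n (n - 1)"
  then have len: "length w = n" and set: "set w = {1..n - 1}" by (simp_all add: rgf_words_def)
  have "card (set w) < length w" unfolding len set using assms by simp
  then have "\<not> distinct w" using distinct_card by fastforce
  then obtain xs ys v y where "w = xs @ [y] @ ys @ [y] @ v"
    using not_distinct_decomp by blast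
  then have eq: "w = (xs @ y # ys) @ y # v" by simp
  define p where "p = xs @ y # ys"
  have p: "w = p @ y # v" "y \<in> set p" using eq by (simp_all add: p_def)
  have "p @ v \<in> rgf_words (n - 1) (n - 1)"
    using w p(2) assms unfolding p(1) by (intro rgf_words_delete[of p y v]) simp_all
  then have pv: "p @ v = [1..<n]" using assms by (simp add: rgf_words_full del: upt_Suc)
  have m: "length p \<le> n - 1" using arg_cong[OF pv, of length] by simp
  have "p = take (length p) (p @ v)" by simp
  also have "\<dots> = [1..<Suc (length p)]" unfolding pv using m assms by (simp del: upt_Suc)
  finally have p_eq: "p = [1..<Suc (length p)]" .
  have "v = drop (length p) (p @ v)" by simp
  also have "\<dots> = [Suc (length p)..<n]" unfolding pv by simp
  finally have v_eq: "v = [Suc (length p)..<n]" .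
  have "y \<in> set [1..<Suc (length p)]" using p(2) p_eq by simp
  then have "1 \<le> y \<and> y \<le> length p" by (simp del: upt_Suc)
  moreover have "w = ins_word n (length p) y"
    unfolding ins_word_def p(1) using p_eq v_eq by simp
  ultimately show "w \<in> {ins_word n m a | m a. 1 \<le> a \<and> a \<le> m \<and> m \<le> n - 1}" using m by blast
next
  fix w assume "w \<in> {ins_word n m a | m a. 1 \<le> a \<and> a \<le> m \<and> m \<le> n - 1}"
  then obtain m a where w: "w = ins_word n m a" and ma: "1 \<le> a" "a \<le> m" "m \<le> n - 1" by blast
  have "[1..<n] \<in> rgf_words (n - 1) (n - 1)"
    using rgf_words_full[of "n - 1"] assms by (simp del: upt_Suc)
  moreover have "[1..<n] = [1..<Suc m] @ [Suc m..<n]" using ma assms by (intro upt_split[symmetric]) simp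
  ultimately have "[1..<Suc m] @ a # [Suc m..<n] \<in> rgf_words (Suc (n - 1)) (n - 1)"
    using ma by (intro rgf_words_insert) (simp_all del: upt_Suc)
  then show "w \<in> rgf_words n (n - 1)" using assms by (simp add: w ins_word_def del: upt_Suc)
qed

lemma count_ins_word:
  assumes "m < n"
  shows "count (mset (ins_word n m a)) x = (if 1 \<le> x \<and> x < n then 1 else 0) + (if x = a then 1 else 0)"
proof -
  have "mset (ins_word n m a) = add_mset a (mset ([1..<Suc m] @ [Suc m..<n]))"
    by (simp add: ins_word_def del: upt_Suc)
  also have "\<dots> = add_mset a (mset_set {1..<n})"
    unfolding upt_split[OF assms] by simp
  finally show ?thesis by (simp add: count_mset_set')
qed

lemma count_ins_word_ge_2:
  assumes "m < n" "2 \<le> count (mset (ins_word n m a)) x"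
  shows "x = a"
  using assms(2) unfolding count_ins_word[OF assms(1)] by (auto split: if_splits)

context
  fixes n m a :: nat
  assumes a: "1 \<le> a" and am: "a \<le> m" and mn: "m < n"
begin

lemma ins_word_Cons: "ins_word n m a = 1 # ([2..<Suc m] @ a # [Suc m..<n])"
proof -
  have "[1..<Suc m] = 1 # [2..<Suc m]" using a am by (simp add: upt_conv_Cons numeral_2_eq_2)
  then show ?thesis by (simp add: ins_word_def del: upt_Suc)
qed

lemma count_ins_word_letter: "count (mset (ins_word n m a)) a = 2"
  unfolding count_ins_word[OF mn] using a am mn by simp

lemma ins_word_avoids_1_23:
  "(\<forall>x y. subseq [x, y, y] (ins_word n m a) \<longrightarrow> x = y) \<longleftrightarrow> a = 1"
proof
  assume "\<forall>x y. subseq [x, y, y] (ins_word n m a) \<longrightarrow> x = y"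
  from avoids_1_23_repeated[OF this ins_word_Cons, of a] show "a = 1"
    by (simp only: count_ins_word_letter)
next
  assume "a = 1"
  show "\<forall>x y. subseq [x, y, y] (ins_word n m a) \<longrightarrow> x = y"
  proof (intro allI impI, rule ccontr)
    fix x y assume xy: "subseq [x, y, y] (ins_word n m a)" "x \<noteq> y"
    then have "y = 1"
      using count_ins_word_ge_2[OF mn count_ge_2_if_subseq(1)] \<open>a = 1\<close> by blast
    \<comment> \<open>As \<open>x\<close> differs from 1, the leading 1 is not part of the subword,
      so two further letters 1 are needed. That would be three in all, but the word has two.\<close>
    then have "subseq [x, 1, 1] ([2..<Suc m] @ a # [Suc m..<n])"
      using xy unfolding ins_word_Cons by (simp del: upt_Suc)
    then have "2 \<le> count (mset ([2..<Suc m] @ a # [Suc m..<n])) 1"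
      by (rule count_ge_2_if_subseq(1))
    then have "3 \<le> count (mset (ins_word n m a)) 1"
      unfolding ins_word_Cons by (simp del: upt_Suc)
    then show False using count_ins_word_letter \<open>a = 1\<close> by simp
  qed
qed

lemma ins_word_avoids_12_3:
  "(\<forall>x y. subseq [x, x, y] (ins_word n m a) \<longrightarrow> x = y) \<longleftrightarrow> m = n - 1"
proof
  assume av: "\<forall>x y. subseq [x, x, y] (ins_word n m a) \<longrightarrow> x = y"
  show "m = n - 1"
  proof (rule ccontr)
    assume "m \<noteq> n - 1"
    \<comment> \<open>A nonempty run after the inserted letter makes \<open>n - 1\<close> the last
      letter of the word. It is larger than \<open>a\<close> and follows both copies of
      \<open>a\<close>.\<close>
    then have "[Suc m..<n] = [Suc m..<n - 1] @ [n - 1]"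
      using mn upt_Suc_append[of "Suc m" "n - 1"] by simp
    then have "ins_word n m a = ([1..<Suc m] @ a # [Suc m..<n - 1]) @ [n - 1]"
      by (simp add: ins_word_def del: upt_Suc)
    from avoids_12_3_repeated[OF av this, of a] have "a = n - 1"
      by (simp only: count_ins_word_letter)
    then show False using am mn \<open>m \<noteq> n - 1\<close> by linarith
  qed
next
  assume m: "m = n - 1"
  then have w: "ins_word n m a = [1..<n] @ [a]" using mn by (simp add: ins_word_def)
  show "\<forall>x y. subseq [x, x, y] (ins_word n m a) \<longrightarrow> x = y"
  proof (intro allI impI, rule ccontr)
    fix x y assume "subseq [x, x, y] (ins_word n m a)" "x \<noteq> y"
    then obtain i j l where ijl: "i < j" "j < l" "l < length (ins_word n m a)"
      "ins_word n m a ! i = ins_word n m a ! j"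
      unfolding subseq_three_iff_nth by metis
    \<comment> \<open>The inserted letter is last, so the first two positions of the subword lie in
      the repetition-free run.\<close>
    then have "i < length [1..<n]" "j < length [1..<n]" unfolding w by auto
    then have "[1..<n] ! i = [1..<n] ! j" using ijl(4) unfolding w nth_append by simp
    then show False using \<open>i < length _\<close> \<open>j < length _\<close> ijl(1) by simp
  qed
qed

lemma ins_word_avoids_123: "\<not> subseq [x, x, x] (ins_word n m a)"
  unfolding subseq_three_iff count_ins_word[OF mn] by simp

text \<open>Only the inserted letter has larger ones before it, namely a + 1, ..., m.\<close>

lemma lb_ins_word: "lb (ins_word n m a) = m - a"
proof -
  have "lb (([1..<Suc m] @ [a]) @ [Suc m..<n]) = lb ([1..<Suc m] @ [a])"
    using am by (intro lb_append_increasing) (auto simp del: upt_Suc)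
  also have "\<dots> = card {y \<in> set [1..<Suc m]. a < y}"
    by (simp only: lb_snoc lb_sorted[OF sorted_upt] add_0)
  also have "{y \<in> set [1..<Suc m]. a < y} = {a<..m}" using a by (auto simp del: upt_Suc)
  finally show ?thesis by (simp add: ins_word_def del: upt_Suc)
qed

lemma sum_list_ins_word:
  "(\<Sum>x\<leftarrow>ins_word n m a. f x) = (\<Sum>x = 1..n - 1. f x) + (f a :: nat)"
proof -
  have "(\<Sum>x\<leftarrow>ins_word n m a. f x) = (\<Sum>x\<leftarrow>[1..<Suc m] @ [Suc m..<n]. f x) + f a"
    by (simp add: ins_word_def del: upt_Suc)
  also have "(\<Sum>x\<leftarrow>[1..<Suc m] @ [Suc m..<n]. f x) = (\<Sum>x = 1..<n. f x)"
    unfolding upt_split[OF mn] by (simp add: interv_sum_list_conv_sum_set_nat)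
  also have "{1..<n} = {1..n - 1}" using mn by auto
  finally show ?thesis .
qed

lemma ins_word_in_rgf_words: "ins_word n m a \<in> rgf_words n (n - 1)"
proof -
  have "2 \<le> n" using a am mn by linarith
  then show ?thesis
    unfolding rgf_words_one_less[OF \<open>2 \<le> n\<close>] using a am mn
    by (intro CollectI exI[of _ m] exI[of _ a]) simp
qed

lemma ls_ins_word: "ls (ins_word n m a) = (n - 1 choose 2) + (a - 1)"
  unfolding ls_rgf_words[OF ins_word_in_rgf_words] sum_list_ins_word sum_pred_eq_choose_two ..

text \<open>Every other letter sees all values above it. The inserted \<open>a\<close> sees only m +
  1, ..., n - 1 and contributes \<open>n - 1 - m\<close> in place of
  \<open>n - 1 - a\<close>.\<close>

lemma rb_ins_word: "rb (ins_word n m a) = (n - 1 choose 2) + (n - 1 - m)"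
proof -
  have "set (a # [Suc m..<n]) \<subseteq> {..n - 1}" using am mn by auto
  moreover have "{Suc m..n - 1} \<subseteq> set (a # [Suc m..<n])" by auto
  ultimately have "rb ([1..<Suc m] @ a # [Suc m..<n])
      = (\<Sum>x\<leftarrow>[1..<Suc m]. n - 1 - x) + rb (a # [Suc m..<n])"
    using mn by (intro rb_upt_append) auto
  also have "rb (a # [Suc m..<n]) = rb [Suc m..<n] + card {Suc m..<n}"
  proof -
    have "{y \<in> set [Suc m..<n]. a < y} = {Suc m..<n}" using am by auto
    then show ?thesis by (simp only: rb_Cons)
  qed
  also have "rb [Suc m..<n] = (\<Sum>x\<leftarrow>[Suc m..<n]. n - 1 - x)"
    using rb_upt_append[of "[]" "n - 1" n "Suc m"] mn by simp
  finally have "rb (ins_word n m a) + (n - 1 - a) = (\<Sum>x\<leftarrow>ins_word n m a. n - 1 - x) + (n - 1 - m)"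
    by (simp add: ins_word_def del: upt_Suc)
  then show ?thesis unfolding sum_list_ins_word sum_codiff_eq_choose_two by linarith
qed

text \<open>The letters a + 1, ..., m of the first run each see exactly one smaller value to the
  right, the inserted \<open>a\<close>; no other letter sees any.\<close>

lemma rs_ins_word: "rs (ins_word n m a) = m - a"
proof -
  have *: "rs (u @ a # v) = length u"
    if "\<forall>x\<in>set u. a < x" "\<forall>y\<in>set v. \<forall>x\<in>set u. x \<le> y" "sorted u" "sorted (a # v)" for u v
    using that
  proof (induction u)
    case Nil
    then show ?case by (simp only: rs_sorted append_Nil list.size)
  next
    case (Cons x u)
    have "{y \<in> set (u @ a # v). y < x} = {a}"
      using Cons.prems by fastforce
    moreover have "rs (u @ a # v) = length u"
      using Cons.prems by (intro Cons.IH) auto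
    ultimately show ?case by (simp add: rs_Cons)
  qed
  have "rs ([Suc a..<Suc m] @ a # [Suc m..<n]) = length [Suc a..<Suc m]"
    using am by (intro *) (auto simp del: upt_Suc)
  then have "rs ([Suc a..<Suc m] @ a # [Suc m..<n]) = m - a" by (simp only: length_upt diff_Suc_Suc)
  moreover have "rs ([1..<Suc a] @ ([Suc a..<Suc m] @ a # [Suc m..<n])) = rs ([Suc a..<Suc m] @ a # [Suc m..<n])"
    using am by (intro rs_append_increasing) (auto simp del: upt_Suc)
  moreover have "[1..<Suc a] @ [Suc a..<Suc m] = [1..<Suc m]"
    using am upt_split[of a "Suc m"] by simp
  ultimately show ?thesis unfolding ins_word_def by (metis append.assoc)
qed

lemma weight_ins_word:
  "weight q r s t (ins_word n m a)
    = (q * t) ^ (m - a) * r ^ ((n - 1 choose 2) + (a - 1)) * s ^ ((n - 1 choose 2) + (n - 1 - m))"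
  unfolding weight_def lb_ins_word ls_ins_word rb_ins_word rs_ins_word
  by (simp add: power_mult_distrib mult_ac)

end

section \<open>Generating functions for n - 1 blocks\<close>

text \<open>The sum is over words, not over pairs \<open>(m, a)\<close>; that different parameters
  give different words is checked where the sum is reindexed.\<close>

lemma F_one_less:
  assumes "2 \<le> n"
    and "\<And>\<pi>. partition_on {1..n} \<pi> \<Longrightarrow> card \<pi> = n - 1 \<Longrightarrow> (\<forall>\<omega>\<in>P. avoids \<pi> \<omega>) \<longleftrightarrow> Q (rgf n \<pi>)"
    and "\<And>m a. 1 \<le> a \<Longrightarrow> a \<le> m \<Longrightarrow> m < n \<Longrightarrow> Q (ins_word n m a) \<longleftrightarrow> R m a"
  shows "F n (n - 1) P q r s t = (\<Sum>w | \<exists>m a. w = ins_word n m a \<and> 1 \<le> a \<and> a \<le> m \<and> m < n \<and> R m a.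
    weight q r s t w)"
proof -
  have "F n (n - 1) P q r s t = (\<Sum>w | w \<in> rgf_words n (n - 1) \<and> Q w. weight q r s t w)"
    by (rule F_eq_sum_words) (rule assms(2))
  also have "{w. w \<in> rgf_words n (n - 1) \<and> Q w}
      = {w. \<exists>m a. w = ins_word n m a \<and> 1 \<le> a \<and> a \<le> m \<and> m < n \<and> R m a}"
  proof -
    have "m \<le> n - 1 \<longleftrightarrow> m < n" for m using assms(1) by auto
    then show ?thesis unfolding rgf_words_one_less[OF assms(1)] using assms(3) by blast
  qed
  finally show ?thesis .
qed

lemma choose_two_pred: "2 \<le> n \<Longrightarrow> n choose 2 = (n - 1 choose 2) + (n - 1)"
  by (cases n) (simp_all add: numeral_2_eq_2)

lemma F_1_23_12_3:
  assumes "2 \<le> n"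
  shows "F n (n - 1) {pat_1_23, pat_12_3} q r s t = (q * t) ^ (n - 2) * (r * s) ^ (n - 1 choose 2)"
proof -
  have "F n (n - 1) {pat_1_23, pat_12_3} q r s t =
    (\<Sum>w | \<exists>m a. w = ins_word n m a \<and> 1 \<le> a \<and> a \<le> m \<and> m < n \<and> (a = 1 \<and> m = n - 1). weight q r s t w)"
    by (rule F_one_less[where Q = "\<lambda>w. (\<forall>a b. subseq [a, b, b] w \<longrightarrow> a = b) \<and> (\<forall>a b. subseq [a, a, b] w \<longrightarrow> a = b)"])
      (use assms in \<open>simp_all add: avoids_iff_subseq ins_word_avoids_1_23 ins_word_avoids_12_3\<close>)
  also have "{w. \<exists>m a. w = ins_word n m a \<and> 1 \<le> a \<and> a \<le> m \<and> m < n \<and> (a = 1 \<and> m = n - 1)}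
      = {ins_word n (n - 1) 1}"
    using assms by auto
  finally show ?thesis
    using assms weight_ins_word[of 1 "n - 1" n q r s t]
    by (simp add: power_mult_distrib mult_ac numeral_2_eq_2)
qed

lemma F_1_23_123:
  assumes "2 \<le> n"
  shows "F n (n - 1) {pat_1_23, pat_123} q r s t
    = r ^ (n - 1 choose 2) * (\<Sum>i = 0..n - 2. (q * t) ^ i * s ^ ((n choose 2) - i - 1))"
proof -
  have "F n (n - 1) {pat_1_23, pat_123} q r s t =
    (\<Sum>w | \<exists>m a. w = ins_word n m a \<and> 1 \<le> a \<and> a \<le> m \<and> m < n \<and> a = 1. weight q r s t w)"
    by (rule F_one_less[where Q = "\<lambda>w. (\<forall>a b. subseq [a, b, b] w \<longrightarrow> a = b) \<and> (\<forall>a. \<not> subseq [a, a, a] w)"])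
      (use assms in \<open>simp_all add: avoids_iff_subseq ins_word_avoids_1_23 ins_word_avoids_123\<close>)
  also have "{w. \<exists>m a. w = ins_word n m a \<and> 1 \<le> a \<and> a \<le> m \<and> m < n \<and> a = 1}
      = (\<lambda>i. ins_word n (Suc i) 1) ` {0..n - 2}" (is "?A = ?B")
  proof (intro set_eqI iffI)
    fix w assume "w \<in> ?A"
    then obtain m where m: "w = ins_word n m 1" "1 \<le> m" "m < n" by blast
    then show "w \<in> ?B" by (intro image_eqI[of _ _ "m - 1"]) auto
  next
    fix w assume "w \<in> ?B"
    then obtain i where i: "w = ins_word n (Suc i) 1" "i \<le> n - 2" by auto
    then show "w \<in> ?A" using assms by (intro CollectI exI[of _ "Suc i"] exI[of _ 1]) auto
  qed
  also have "(\<Sum>w\<in>?B. weight q r s t w) = (\<Sum>i = 0..n - 2. weight q r s t (ins_word n (Suc i) 1))"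
  proof (rule sum.reindex_cong[OF _ refl refl], rule inj_onI)
    fix i j assume "i \<in> {0..n - 2}" "j \<in> {0..n - 2}" "ins_word n (Suc i) 1 = ins_word n (Suc j) 1"
    \<comment> \<open>With \<open>a = 1\<close> and \<open>m = Suc i\<close> the value of
      \<open>lb\<close> is \<open>i\<close>, so it separates the words.\<close>
    then have "lb (ins_word n (Suc i) 1) = lb (ins_word n (Suc j) 1)" "Suc i < n" "Suc j < n"
      using assms by auto
    then show "i = j" by (simp add: lb_ins_word)
  qed
  also have "\<dots> = (\<Sum>i = 0..n - 2. r ^ (n - 1 choose 2) * ((q * t) ^ i * s ^ ((n choose 2) - i - 1)))"
  proof (rule sum.cong[OF refl])
    fix i assume "i \<in> {0..n - 2}"
    then have i: "Suc i < n" using assms by auto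
    have "(n - 1 choose 2) + (n - 1 - Suc i) = (n choose 2) - i - 1"
      using choose_two_pred[OF assms] i by linarith
    then show "weight q r s t (ins_word n (Suc i) 1)
        = r ^ (n - 1 choose 2) * ((q * t) ^ i * s ^ ((n choose 2) - i - 1))"
      using weight_ins_word[of 1 "Suc i" n q r s t] i by (simp add: mult_ac)
  qed
  finally show ?thesis by (simp only: sum_distrib_left)
qed

lemma F_12_3_123:
  assumes "2 \<le> n"
  shows "F n (n - 1) {pat_12_3, pat_123} q r s t
    = s ^ (n - 1 choose 2) * (\<Sum>i = 0..n - 2. (q * t) ^ i * r ^ ((n choose 2) - i - 1))"
proof -
  have "F n (n - 1) {pat_12_3, pat_123} q r s t =
    (\<Sum>w | \<exists>m a. w = ins_word n m a \<and> 1 \<le> a \<and> a \<le> m \<and> m < n \<and> m = n - 1. weight q r s t w)"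
    by (rule F_one_less[where Q = "\<lambda>w. (\<forall>a b. subseq [a, a, b] w \<longrightarrow> a = b) \<and> (\<forall>a. \<not> subseq [a, a, a] w)"])
      (use assms in \<open>simp_all add: avoids_iff_subseq ins_word_avoids_12_3 ins_word_avoids_123\<close>)
  also have "{w. \<exists>m a. w = ins_word n m a \<and> 1 \<le> a \<and> a \<le> m \<and> m < n \<and> m = n - 1}
      = (\<lambda>i. ins_word n (n - 1) (n - 1 - i)) ` {0..n - 2}" (is "?A = ?B")
  proof (intro set_eqI iffI)
    fix w assume "w \<in> ?A"
    then obtain a where a: "w = ins_word n (n - 1) a" "1 \<le> a" "a \<le> n - 1" by blast
    then show "w \<in> ?B" by (intro image_eqI[of _ _ "n - 1 - a"]) auto
  next
    fix w assume "w \<in> ?B"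
    then obtain i where i: "w = ins_word n (n - 1) (n - 1 - i)" "i \<le> n - 2" by auto
    then show "w \<in> ?A" using assms
      by (intro CollectI exI[of _ "n - 1"] exI[of _ "n - 1 - i"]) auto
  qed
  also have "(\<Sum>w\<in>?B. weight q r s t w) = (\<Sum>i = 0..n - 2. weight q r s t (ins_word n (n - 1) (n - 1 - i)))"
  proof (rule sum.reindex_cong[OF _ refl refl], rule inj_onI)
    fix i j assume "i \<in> {0..n - 2}" "j \<in> {0..n - 2}"
      "ins_word n (n - 1) (n - 1 - i) = ins_word n (n - 1) (n - 1 - j)"
    then have "n - 1 - i = n - 1 - j" "i < n - 1" "j < n - 1"
      using assms by (auto simp: ins_word_def)
    then show "i = j" by linarith
  qed
  also have "\<dots> = (\<Sum>i = 0..n - 2. s ^ (n - 1 choose 2) * ((q * t) ^ i * r ^ ((n choose 2) - i - 1)))"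
  proof (rule sum.cong[OF refl])
    fix i assume "i \<in> {0..n - 2}"
    then have i: "i < n - 1" using assms by auto
    have "(n - 1 choose 2) + (n - 1 - i - 1) = (n choose 2) - i - 1"
      using choose_two_pred[OF assms] i by linarith
    moreover have "n - 1 - (n - 1 - i) = i" using i by linarith
    ultimately show "weight q r s t (ins_word n (n - 1) (n - 1 - i))
        = s ^ (n - 1 choose 2) * ((q * t) ^ i * r ^ ((n choose 2) - i - 1))"
      using weight_ins_word[of "n - 1 - i" "n - 1" n q r s t] i by (simp add: mult_ac)
  qed
  finally show ?thesis by (simp only: sum_distrib_left)
qed

subsection \<open>Two blocks\<close>

text \<open>With two letters, restricted growth only asks that a 1 precede every 2, which the
  leading 1 guarantees.\<close>

lemma rgf_words_2:
  assumes "set (1 # v) = {1, 2}"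
  shows "1 # v \<in> rgf_words (Suc (length v)) 2"
proof -
  have "{1..<x} \<subseteq> set u" if eq: "1 # v = u @ x # v'" for u x v'
  proof (cases u)
    case Nil
    then show ?thesis using eq by simp
  next
    case (Cons y u')
    have "x \<in> set (1 # v)" unfolding eq by simp
    then have "x \<in> {1, 2}" unfolding assms .
    then show ?thesis using eq Cons by auto
  qed
  moreover have "{1, 2} = {1..2 :: nat}" by auto
  moreover have "length (1 # v) = Suc (length v)" by simp
  ultimately show ?thesis using assms unfolding rgf_words_def by blast
qed

text \<open>A two-block word with a single 2. Three of the four words left by 1/23 and 12/3 have
  this shape.\<close>

definition hump :: "nat \<Rightarrow> nat \<Rightarrow> nat list" where
  "hump i j = replicate i 1 @ 2 # replicate j 1"

lemma hump_in_rgf_words: "hump (Suc i) j \<in> rgf_words (Suc (Suc (i + j))) 2"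
proof -
  have "set (1 # replicate i 1 @ 2 # replicate j 1) = {1, 2 :: nat}" by auto
  from rgf_words_2[OF this] show ?thesis by (simp add: hump_def)
qed

lemma count_hump: "count (mset (hump i j)) x = (if x = 1 then i + j else if x = 2 then 1 else 0)"
  by (simp add: hump_def)

text \<open>Each 1 after the 2 counts once in \<open>lb\<close>, each 1 before it once in
  \<open>rb\<close>. The 2 counts once in \<open>ls\<close>, and once in \<open>rs\<close> if any 1
  follows, because equal values are counted once.\<close>

lemma weight_hump:
  "weight q r s t (hump (Suc i) j) = q ^ j * r * s ^ Suc i * t ^ (if j = 0 then 0 else 1)"
proof -
  have "lb (hump (Suc i) j) = j"
  proof (induction j)
    case 0
    have "sorted (hump (Suc i) 0)" by (auto simp: hump_def sorted_append sorted_replicate)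
    then show ?case by (rule lb_sorted)
  next
    case (Suc j)
    have "hump (Suc i) (Suc j) = hump (Suc i) j @ [1]"
      by (simp add: hump_def replicate_append_same)
    moreover have "{y \<in> set (hump (Suc i) j). 1 < y} = {2}" by (auto simp: hump_def)
    ultimately show ?case using Suc by (simp only: lb_snoc) simp
  qed
  moreover have "ls (hump (Suc i) j) = 1"
    unfolding ls_rgf_words[OF hump_in_rgf_words] by (simp add: hump_def sum_list_replicate)
  moreover have "rb (hump i j) = i" for i
  proof (induction i)
    case 0
    have "rb (replicate j 1) = 0" by (induction j) (simp_all add: rb_Cons)
    then show ?case by (simp add: hump_def rb_Cons)
  next
    case (Suc i)
    have "{y \<in> set (hump i j). 1 < y} = {2}" by (auto simp: hump_def)
    then have "rb (1 # hump i j) = Suc i" using Suc by (simp only: rb_Cons) simp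
    then show ?case by (simp add: hump_def)
  qed
  moreover have "rs (hump i j) = (if j = 0 then 0 else 1)" for i
  proof -
    have "rs (hump i j) = rs (2 # replicate j 1)"
      unfolding hump_def by (rule rs_append_increasing) (auto simp: sorted_replicate)
    moreover have "{y \<in> set (replicate j 1). y < 2} = (if j = 0 then {} else {1 :: nat})" by auto
    moreover have "rs (replicate j 1) = 0" by (simp add: rs_sorted sorted_replicate)
    ultimately show ?thesis by (simp add: rs_Cons)
  qed
  ultimately show ?thesis by (simp add: weight_def)
qed

lemma hump_eqI:
  assumes "w \<in> rgf_words n 2" "count (mset w) 2 \<le> 1"
  obtains i j where "w = hump i j"
proof -
  have set: "set w = {1..2}" using assms(1) by (simp add: rgf_words_def)
  then have "2 \<in> set w" by simp
  then obtain u v where w: "w = u @ 2 # v" by (metis split_list)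
  have "count (mset u) 2 = 0 \<and> count (mset v) 2 = 0" using assms(2) by (simp add: w)
  then have "2 \<notin> set u" "2 \<notin> set v" by simp_all
  moreover have "set u \<subseteq> {1..2}" "set v \<subseteq> {1..2}" unfolding set[symmetric] w by auto
  moreover have "x = 1 \<or> x = 2" if "x \<in> {1..2}" for x :: nat using that by auto
  ultimately have "u = replicate (length u) 1" "v = replicate (length v) 1"
    by (metis replicate_eqI subsetD)+
  then show thesis using that w unfolding hump_def by metis
qed

text \<open>The first letter is 1, so 2 cannot repeat; after the single 2 at most one 1 may follow.
  With \<open>3 \<le> n\<close> both remaining words begin with 1.\<close>

lemma F_1_2_3_1_23:
  assumes "3 \<le> n"
  shows "F n 2 {pat_1_2_3, pat_1_23} q r s t = r * s ^ (n - 1) + q * r * s ^ (n - 2) * t"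
proof -
  define Q where "Q w \<longleftrightarrow> (\<forall>a b. subseq [a, b, b] w \<longrightarrow> a = b)" for w :: "nat list"
  have "F n 2 {pat_1_2_3, pat_1_23} q r s t = (\<Sum>w | w \<in> rgf_words n 2 \<and> Q w. weight q r s t w)"
    using avoids_1_2_3_two_blocks
    by (intro F_eq_sum_words) (simp add: avoids_iff_subseq(2) Q_def)
  also have "{w. w \<in> rgf_words n 2 \<and> Q w} = {hump (n - 1) 0, hump (n - 2) 1}"
  proof (intro set_eqI iffI)
    fix w assume "w \<in> {w. w \<in> rgf_words n 2 \<and> Q w}"
    then have w: "w \<in> rgf_words n 2" "Q w" by simp_all
    obtain v where v: "w = 1 # v" using rgf_words_Cons_1[OF w(1)] by auto
    have "\<not> 2 \<le> count (mset w) 2"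
      using avoids_1_23_repeated[OF w(2)[unfolded Q_def] v, of 2] by auto
    then obtain i j where ij: "w = hump i j" using hump_eqI[OF w(1)] by auto
    have n: "n = Suc (i + j)" using w(1) unfolding rgf_words_def ij by (simp add: hump_def)
    have "j \<le> 1"
    proof (rule ccontr)
      assume "\<not> j \<le> 1"
      then have "subseq [1, 1 :: nat] (replicate j 1)" unfolding subseq_two_iff by simp
      then have "subseq [2, 1, 1] w" unfolding ij hump_def by (intro subseq_drop_many) simp
      then have "(2 :: nat) = 1" using w(2) unfolding Q_def by blast
      then show False by simp
    qed
    then have "j = 0 \<or> j = 1" by auto
    then show "w \<in> {hump (n - 1) 0, hump (n - 2) 1}" using ij n by auto
  next
    fix w assume "w \<in> {hump (n - 1) 0, hump (n - 2) 1}"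
    then obtain i j where w: "w = hump (Suc i) j" "j \<le> 1" "n = Suc (Suc (i + j))"
    proof (elim insertE emptyE)
      assume "w = hump (n - 1) 0"
      then show thesis using that[of "n - 2" 0] assms by (simp add: Suc_diff_Suc numeral_2_eq_2)
    next
      assume "w = hump (n - 2) 1"
      then show thesis using that[of "n - 3" 1] assms by (simp add: Suc_diff_Suc numeral_2_eq_2 numeral_3_eq_3)
    qed
    have "Q w" unfolding Q_def
    proof (intro allI impI, rule ccontr)
      fix a b assume ab: "subseq [a, b, b] w" "a \<noteq> b"
      then have "2 \<le> count (mset w) b" by (intro count_ge_2_if_subseq)
      then have "b = 1" unfolding w(1) count_hump by (auto split: if_splits)
      then have "a \<noteq> 1" using ab(2) by simp
      \<comment> \<open>The leading letters 1 cannot match \<open>a\<close>, so the subword starts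
        at the 2 or later, where at most one 1 is left.\<close>
      then have "subseq [a, 1, 1] (2 # replicate j 1)"
        using ab(1) unfolding w(1) hump_def \<open>b = 1\<close> by (subst (asm) subseq_append_irrelevant) auto
      then have "subseq [1, 1 :: nat] (replicate j 1)"
        by (cases "a = 2") (auto dest: subseq_Cons')
      then show False unfolding subseq_two_iff using w(2) by simp
    qed
    then show "w \<in> {w. w \<in> rgf_words n 2 \<and> Q w}" using hump_in_rgf_words w by simp
  qed
  also have "(\<Sum>w\<in>{hump (n - 1) 0, hump (n - 2) 1}. weight q r s t w)
      = weight q r s t (hump (n - 1) 0) + weight q r s t (hump (n - 2) 1)"
  proof -
    have "last (hump (n - 1) 0) \<noteq> last (hump (n - 2) 1)" by (simp add: hump_def)
    then have "hump (n - 1) 0 \<noteq> hump (n - 2) 1" by metis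
    then show ?thesis by simp
  qed
  also have "\<dots> = r * s ^ (n - 1) + q * r * s ^ (n - 2) * t"
    using weight_hump[of q r s t "n - 2" 0] weight_hump[of q r s t "n - 3" 1] assms
    by (simp add: Suc_diff_Suc numeral_2_eq_2 numeral_3_eq_3 mult_ac)
  finally show ?thesis .
qed

text \<open>A second letter 1 would give 1 1 2 with some later 2, so the word starts with 1 2. The
  third letter repeats one of these two, and then 12/3 forces every later letter to equal
  it.\<close>

lemma F_1_2_3_12_3:
  assumes "3 \<le> n"
  shows "F n 2 {pat_1_2_3, pat_12_3} q r s t = r ^ (n - 1) * s + q ^ (n - 2) * r * s * t"
proof -
  define Q where "Q w \<longleftrightarrow> (\<forall>a b. subseq [a, a, b] w \<longrightarrow> a = b)" for w :: "nat list"
  let ?inc = "1 # replicate (n - 1) (2 :: nat)"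
  have "F n 2 {pat_1_2_3, pat_12_3} q r s t = (\<Sum>w | w \<in> rgf_words n 2 \<and> Q w. weight q r s t w)"
    using avoids_1_2_3_two_blocks
    by (intro F_eq_sum_words) (simp add: avoids_iff_subseq(4) Q_def)
  also have "{w. w \<in> rgf_words n 2 \<and> Q w} = {?inc, hump 1 (n - 2)}"
  proof (intro set_eqI iffI)
    fix w assume "w \<in> {w. w \<in> rgf_words n 2 \<and> Q w}"
    then have w: "w \<in> rgf_words n 2" "Q w" by simp_all
    then have len: "length w = n" and set: "set w = {1..2}" by (simp_all add: rgf_words_def)
    obtain v where v: "w = 1 # v" using rgf_words_Cons_1[OF w(1)] by auto
    obtain x y z where xyz: "v = x # y # z"
      using len assms unfolding v by (cases v rule: remdups_adj.cases) auto
    have two: "a = 1 \<or> a = 2" if "a \<in> set w" for a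
    proof -
      have "a \<in> {1..2}" using that unfolding set .
      then show ?thesis by auto
    qed
    have "2 \<in> set w" unfolding set by simp
    have "x = 2"
    proof (rule ccontr)
      assume "x \<noteq> 2"
      then have "x = 1" using two[of x] by (simp add: v xyz)
      then have "2 \<in> set (y # z)" using \<open>2 \<in> set w\<close> unfolding v xyz by simp
      then have "subseq [2] (y # z)" by (simp only: subseq_singleton_left)
      then have "subseq [1, 1, 2] w" unfolding v xyz \<open>x = 1\<close> by (intro subseq_Cons2)
      then have "(1 :: nat) = 2" using w(2) unfolding Q_def by blast
      then show False by simp
    qed
    have same: "b = y" if "b \<in> set z" for b
    proof -
      have "subseq [b] z" using that by (simp add: subseq_singleton_left)
      then have "subseq [y, b] (y # z)" by simp
      moreover have "y = 1 \<or> y = 2" using two[of y] by (simp add: v xyz)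
      ultimately have "subseq [y, y, b] w" unfolding v xyz \<open>x = 2\<close> by auto
      then show ?thesis using w(2) unfolding Q_def by blast
    qed
    then have z: "z = replicate (n - 3) y"
      using len unfolding v xyz by (intro replicate_eqI) auto
    have y: "y = 1 \<or> y = 2" using two[of y] by (simp add: v xyz)
    have "n - 1 = Suc (Suc (n - 3))" "n - 2 = Suc (n - 3)" using assms by simp_all
    then show "w \<in> {?inc, hump 1 (n - 2)}"
      using y unfolding v xyz z \<open>x = 2\<close> hump_def by auto
  next
    fix w assume "w \<in> {?inc, hump 1 (n - 2)}"
    then consider "w = ?inc" | "w = hump 1 (n - 2)" by blast
    then show "w \<in> {w. w \<in> rgf_words n 2 \<and> Q w}"
    proof cases
      case 1
      have "w \<in> rgf_words n 2"
        using rgf_words_2[of "replicate (n - 1) 2"] assms by (auto simp: 1)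
      moreover have "Q w" unfolding Q_def
      proof (intro allI impI, rule ccontr)
        fix a b assume ab: "subseq [a, a, b] w" "a \<noteq> b"
        then have "2 \<le> count (mset w) a" by (intro count_ge_2_if_subseq)
        then have "a = 2" unfolding 1 by (auto split: if_splits)
        then have "subseq [2, 2, b] (replicate (n - 1) 2)" using ab(1) unfolding 1 by simp
        then have "b = 2" using subseq_three_set(3) by fastforce
        then show False using ab(2) \<open>a = 2\<close> by simp
      qed
      ultimately show ?thesis by simp
    next
      case 2
      have "w \<in> rgf_words n 2"
        using hump_in_rgf_words[of 0 "n - 2"] assms by (simp add: 2 Suc_diff_Suc numeral_2_eq_2)
      moreover have "Q w" unfolding Q_def
      proof (intro allI impI, rule ccontr)
        fix a b assume ab: "subseq [a, a, b] w" "a \<noteq> b"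
        then have "2 \<le> count (mset w) a" by (intro count_ge_2_if_subseq)
        then have "a = 1" unfolding 2 count_hump by (auto split: if_splits)
        then have "subseq [1, b] (2 # replicate (n - 2) 1)" using ab(1) by (simp add: 2 hump_def)
        then have "subseq [1, b] (replicate (n - 2) 1)" by simp
        then have "subseq [b] (replicate (n - 2) 1)" by (rule subseq_Cons')
        then have "b = 1" by (simp add: subseq_singleton_left)
        then show False using ab(2) \<open>a = 1\<close> by simp
      qed
      ultimately show ?thesis by simp
    qed
  qed
  also have "(\<Sum>w\<in>{?inc, hump 1 (n - 2)}. weight q r s t w)
      = weight q r s t ?inc + weight q r s t (hump 1 (n - 2))"
  proof -
    \<comment> \<open>The two words differ in their number of letters 1, as
      \<open>3 \<le> n\<close>.\<close>
    have counts: "count (mset ?inc) 1 = 1" "count (mset (hump 1 (n - 2))) 1 = n - 1"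
      using assms by (simp_all add: count_hump)
    have "?inc \<noteq> hump 1 (n - 2)"
    proof
      assume "?inc = hump 1 (n - 2)"
      then have "1 = n - 1" using counts by (simp only:)
      then show False using assms by simp
    qed
    then show ?thesis by simp
  qed
  also have "weight q r s t ?inc = r ^ (n - 1) * s"
  proof -
    have "sorted ?inc" "set ?inc = {1..2}" using assms by (auto simp: sorted_replicate)
    from weight_sorted[OF this, of q r s t] show ?thesis
      by (simp add: sum_mset_sum_list sum_list_replicate flip: mset_map)
  qed
  also have "weight q r s t (hump 1 (n - 2)) = q ^ (n - 2) * r * s * t"
    using weight_hump[of q r s t 0 "n - 2"] assms by simp
  finally show ?thesis .
qed

theorem theorem7p1:
  fixes n k :: nat and q r s t :: "'a :: comm_semiring_1"
  assumes "n \<ge> 3" and "1 \<le> k" and "k \<le> n"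
  shows
    "((k = 1 \<longrightarrow> F n k {pat_1_2_3, pat_1_23} q r s t = 1) \<and>
      (k = 2 \<longrightarrow> F n k {pat_1_2_3, pat_1_23} q r s t
                  = r * s ^ (n - 1) + q * r * s ^ (n - 2) * t)) \<and>
     ((k = 1 \<longrightarrow> F n k {pat_1_2_3, pat_13_2} q r s t = 1) \<and>
      (k = 2 \<longrightarrow> F n k {pat_1_2_3, pat_13_2} q r s t
                  = (\<Sum>i=1..n - 1. r ^ i * s ^ (n - i)))) \<and>
     ((k = 1 \<longrightarrow> F n k {pat_1_2_3, pat_12_3} q r s t = 1) \<and>
      (k = 2 \<longrightarrow> F n k {pat_1_2_3, pat_12_3} q r s t
                  = r ^ (n - 1) * s + q ^ (n - 2) * r * s * t)) \<and>
     ((k = 1 \<longrightarrow> F n k {pat_1_23, pat_13_2} q r s t = 1) \<and>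
      (k \<noteq> 1 \<longrightarrow> F n k {pat_1_23, pat_13_2} q r s t
                  = r ^ (k * (k - 1) div 2) * s ^ ((k - 1) * (2 * n - k) div 2))) \<and>
     ((k = 1 \<longrightarrow> F n k {pat_1_23, pat_12_3} q r s t = 1) \<and>
      (k = n \<longrightarrow> F n k {pat_1_23, pat_12_3} q r s t = (r * s) ^ (k choose 2)) \<and>
      (k = n - 1 \<longrightarrow> F n k {pat_1_23, pat_12_3} q r s t
                  = (q * t) ^ (k - 1) * (r * s) ^ (k choose 2))) \<and>
     ((k = n \<longrightarrow> F n k {pat_1_23, pat_123} q r s t = (r * s) ^ (k choose 2)) \<and>
      (k = n - 1 \<longrightarrow> F n k {pat_1_23, pat_123} q r s t
                  = r ^ ((n - 1) choose 2)
                    * (\<Sum>i=0..n - 2. (q * t) ^ i * s ^ ((n choose 2) - i - 1)))) \<and>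
     ((k = 1 \<longrightarrow> F n k {pat_13_2, pat_12_3} q r s t = 1) \<and>
      (k \<noteq> 1 \<longrightarrow> F n k {pat_13_2, pat_12_3} q r s t
                  = r ^ ((k - 1) * (2 * n - k) div 2) * s ^ ((k - 1) * k div 2))) \<and>
     (F n k {pat_13_2, pat_123} q r s t
        = (\<Sum>L | L \<subseteq> {1..k} \<and> card L = n - k.
             r ^ ((k choose 2) + (\<Sum>l\<in>L. l - 1)) * s ^ ((k choose 2) + (\<Sum>l\<in>L. k - l)))) \<and>
     ((k = n \<longrightarrow> F n k {pat_12_3, pat_123} q r s t = (r * s) ^ (n * (n - 1) div 2)) \<and>
      (k = n - 1 \<longrightarrow> F n k {pat_12_3, pat_123} q r s t
                  = s ^ ((n - 1) choose 2)
                    * (\<Sum>i=0..n - 2. (q * t) ^ i * r ^ (n * (n - 1) div 2 - i - 1))))"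
proof (intro conjI impI)
  have n: "1 \<le> n" "2 \<le> n" using assms(1) by simp_all
  note one = F_one_block[OF n(1)]
  show "F n k {pat_1_2_3, pat_1_23} q r s t = 1" if "k = 1"
    unfolding that by (rule one) simp
  show "F n k {pat_1_2_3, pat_13_2} q r s t = 1" if "k = 1"
    unfolding that by (rule one) simp
  show "F n k {pat_1_2_3, pat_12_3} q r s t = 1" if "k = 1"
    unfolding that by (rule one) simp
  show "F n k {pat_1_23, pat_13_2} q r s t = 1" if "k = 1"
    unfolding that by (rule one) simp
  show "F n k {pat_1_23, pat_12_3} q r s t = 1" if "k = 1"
    unfolding that by (rule one) simp
  show "F n k {pat_13_2, pat_12_3} q r s t = 1" if "k = 1"
    unfolding that by (rule one) simp
  show "F n k {pat_1_2_3, pat_1_23} q r s t = r * s ^ (n - 1) + q * r * s ^ (n - 2) * t" if "k = 2"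
    using that F_1_2_3_1_23[OF assms(1)] by simp
  show "F n k {pat_1_2_3, pat_13_2} q r s t = (\<Sum>i=1..n - 1. r ^ i * s ^ (n - i))" if "k = 2"
    using that F_1_2_3_13_2[OF n(2)] by simp
  show "F n k {pat_1_2_3, pat_12_3} q r s t = r ^ (n - 1) * s + q ^ (n - 2) * r * s * t" if "k = 2"
    using that F_1_2_3_12_3[OF assms(1)] by simp
  show "F n k {pat_1_23, pat_13_2} q r s t
      = r ^ (k * (k - 1) div 2) * s ^ ((k - 1) * (2 * n - k) div 2)" if "k \<noteq> 1"
    by (rule F_1_23_13_2[OF assms(2,3)])
  show "F n k {pat_1_23, pat_12_3} q r s t = (r * s) ^ (k choose 2)" if "k = n"
    unfolding that by (rule F_n_blocks) simp
  show "F n k {pat_1_23, pat_12_3} q r s t = (q * t) ^ (k - 1) * (r * s) ^ (k choose 2)" if "k = n - 1"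
    using F_1_23_12_3[OF n(2)] unfolding that by (simp add: numeral_2_eq_2)
  show "F n k {pat_1_23, pat_123} q r s t = (r * s) ^ (k choose 2)" if "k = n"
    unfolding that by (rule F_n_blocks) simp
  show "F n k {pat_1_23, pat_123} q r s t
      = r ^ ((n - 1) choose 2) * (\<Sum>i=0..n - 2. (q * t) ^ i * s ^ ((n choose 2) - i - 1))" if "k = n - 1"
    unfolding that by (rule F_1_23_123[OF n(2)])
  show "F n k {pat_13_2, pat_12_3} q r s t
      = r ^ ((k - 1) * (2 * n - k) div 2) * s ^ ((k - 1) * k div 2)" if "k \<noteq> 1"
    by (rule F_13_2_12_3[OF assms(2,3)])
  show "F n k {pat_13_2, pat_123} q r s t
      = (\<Sum>L | L \<subseteq> {1..k} \<and> card L = n - k.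
           r ^ ((k choose 2) + (\<Sum>l\<in>L. l - 1)) * s ^ ((k choose 2) + (\<Sum>l\<in>L. k - l)))"
    by (rule F_13_2_123[OF assms(2,3)])
  show "F n k {pat_12_3, pat_123} q r s t = (r * s) ^ (n * (n - 1) div 2)" if "k = n"
    unfolding that choose_two[symmetric] by (rule F_n_blocks) simp
  show "F n k {pat_12_3, pat_123} q r s t
      = s ^ ((n - 1) choose 2)
        * (\<Sum>i=0..n - 2. (q * t) ^ i * r ^ (n * (n - 1) div 2 - i - 1))" if "k = n - 1"
    unfolding that choose_two[symmetric] by (rule F_12_3_123[OF n(2)])
qed

end
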